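(* Let $\{x^k\}_{k\ge1}$ be generated by the block prox-linear (BPL) method described in the context (under Assumptions 1, 2 and 3 stated there), and suppose the weights $\omega_k$ are chosen so that $F(x^k)\le F(x^{k-1})$ for all $k$. Assume: 1. $\{x^k\}_{k\ge1}$ has a finite limit point $\bar x$; 2. $F$ satisfies the Kurdyka-Łojasiewicz (KL) property at $\bar x$ with parameters $\rho$, $\eta$ and $\theta$; 3. for each $i$, $\nabla_{x_i}f(x)$ is Lipschitz continuous within $\mathcal{B}_{4\rho}(\bar x)$ with respect to $x$. Then $$\lim_{k\to\infty}x^k=\bar x.$$
   Context: Problem: minimize $F(x)=f(x_1,\dots,x_s)+\sum_{i=1}^s r_i(x_i)$ over $x=(x_1,\dots,x_s)\in\mathbb{R}^n$ ($s\ge1$ blocks), with Euclidean norm $\|\cdot\|$. No convexity is assumed. Assumption 1: $f$ is (real-valued and) continuously differentiable; each $r_i$ is proper lower semicontinuous with values in $(-\infty,+\infty]$; $F$ is proper and bounded below on $\mathrm{dom}(F)=\{x:F(x)<+\infty\}$; there is $x^*$ with $0\in\partial F(x^* )$. Subdifferential: $g\in\hat\partial F(x)$ for $x\in\mathrm{dom}(F)$ if $\liminf_{y\to x,\,y\ne x}\frac{F(y)-F(x)-\langle g,y-x\rangle}{\|y-x\|}\ge0$; $\hat\partial F(x)=\emptyset$ for $x\notin\mathrm{dom}(F)$. The limiting subdifferential is $\partial F(x)=\{g:\exists\,x_m\to x,\ g_m\in\hat\partial F(x_m),\ g_m\to g\}$. BPL method: start from $x^{-1}=x^0$. At iteration $k=1,2,\dots$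 a block $b_k\in\{1,\dots,s\}$ is picked; for $i\ne b_k$ set $x_i^k=x_i^{k-1}$; for $i=b_k$ choose $$x_i^k\in\arg\min_{x_i}\ \langle\nabla_{x_i}f(x_{\ne i}^{k-1},\hat x_i^k),x_i-\hat x_i^k\rangle+\frac1{2\alpha_k}\|x_i-\hat x_i^k\|^2+r_i(x_i),\qquad \hat x_i^k=x_i^{k-1}+\omega_k(x_i^{k-1}-x_i^{\mathrm{prev}}),$$ where $(x_{\neq i}^{k-1},u)$ denotes $x^{k-1}$ with its $i$-th block replaced by $u$, $0\le\omega_k\le1$ is an extrapolation weight and $x_i^{\mathrm{prev}}$ is the value of block $i$ before it was updated to $x_i^{k-1}$. Assumption 2: for $i=b_k$, $u\mapsto\nabla_{x_i}f(x_{\ne i}^{k-1},u)$ is Lipschitz with constant $L_k$, and $0<\ell\le L_k\le L<\infty$ for all $k$. Assumption 3: within any $T$ consecutive iterations every block is updated at least once. Parameter choice: let $\tilde L_i^j$ and $\tilde\omega_i^j$ be the values of $L_k$ and $\omega_k$ at the iteration $k$ of the $j$-th update of block $i$ ($\tilde L_i^0>0$ is an arbitrary fixed number). Then $\alpha_k=\frac{1}{2L_k}$ for all $k$ and $\tilde\omega_i^j\le\frac{\delta}{6}\sqrt{\tilde L_i^{j-1}/\tilde L_i^{j}}$ for all $i,j$, for some $0\le\delta<1$. KL property: $\psi$ satisfies the KL property at $\bar x\in\mathrm{dom}(\partial\psi)=\{x:\partial\psi(x)\ne\emptyset\}$ with parameters $\rho,\eta,\theta$ if $\rho,\eta>0$,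 $\theta\in[0,1)$ and there is $c>0$ such that, with $\phi(a)=c\,a^{1-\theta}$, $$\phi'(|\psi(x)-\psi(\bar x)|)\,\mathrm{dist}(0,\partial\psi(x))\ge1\quad\text{for all }x\in\mathcal{B}_\rho(\bar x)\cap\mathrm{dom}(\partial\psi)\text{ with }\psi(\bar x)<\psi(x)<\psi(\bar x)+\eta,$$ where $\mathcal{B}_\rho(\bar x)=\{x:\|x-\bar x\|<\rho\}$ and $\mathrm{dist}(0,\partial\psi(x))=\min\{\|y\|:y\in\partial\psi(x)\}$. *)

theory Defs
  imports "HOL-Analysis.Analysis" "HOL-Library.Infinite_Set"
begin

section \<open>Block structure\<close>

text \<open>
  The decomposition \<open>x = (x\<^sub>1, \<dots>, x\<^sub>s)\<close> of a vector in \<open>real ^ 'n\<close> is given by a map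
  \<open>\<beta> :: 'n \<Rightarrow> 's\<close> assigning to every coordinate the block it belongs to; \<open>'s\<close> is a finite type
  with \<open>s\<close> elements.  The space of the \<open>i\<close>-th block variable is identified with the coordinate
  subspace \<open>block_space \<beta> i\<close>, so that \<open>x\<^sub>i\<close> is \<open>block \<beta> i x\<close> (the coordinates of \<open>x\<close> in block \<open>i\<close>,
  padded with zeros); norms and inner products are preserved.
\<close>

definition block_space :: "('n \<Rightarrow> 's) \<Rightarrow> 's \<Rightarrow> (real ^ 'n) set" where
  "block_space \<beta> i = {u. \<forall>j. \<beta> j \<noteq> i \<longrightarrow> u $ j = 0}"

definition block :: "('n \<Rightarrow> 's) \<Rightarrow> 's \<Rightarrow> real ^ 'n \<Rightarrow> real ^ 'n" where
  "block \<beta> i x = (\<chi> j. if \<beta> j = i then x $ j else 0)"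

text \<open>\<open>replace_block \<beta> i x u\<close> is \<open>(x\<^bsub>\<noteq>i\<^esub>, u)\<close>.\<close>

definition replace_block :: "('n \<Rightarrow> 's) \<Rightarrow> 's \<Rightarrow> real ^ 'n \<Rightarrow> real ^ 'n \<Rightarrow> real ^ 'n" where
  "replace_block \<beta> i x u = (\<chi> j. if \<beta> j = i then u $ j else x $ j)"

text \<open>
  Each \<open>r i\<close> is a function of the \<open>i\<close>-th block variable: only its values on \<open>block_space \<beta> i\<close> matter.
\<close>

definition objective ::
    "('n \<Rightarrow> 's::finite) \<Rightarrow> (real ^ 'n \<Rightarrow> real) \<Rightarrow> ('s \<Rightarrow> real ^ 'n \<Rightarrow> ereal) \<Rightarrow> real ^ 'n \<Rightarrow> ereal" where
  "objective \<beta> f r x = ereal (f x) + (\<Sum>i\<in>UNIV. r i (block \<beta> i x))"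


section \<open>Variational analysis\<close>

definition proper_on :: "'a set \<Rightarrow> ('a \<Rightarrow> ereal) \<Rightarrow> bool" where
  "proper_on S h \<longleftrightarrow> (\<forall>x\<in>S. h x \<noteq> -\<infinity>) \<and> (\<exists>x\<in>S. h x < \<infinity>)"

definition lsc_on :: "'a::topological_space set \<Rightarrow> ('a \<Rightarrow> ereal) \<Rightarrow> bool" where
  "lsc_on S h \<longleftrightarrow> (\<forall>x\<in>S. h x \<le> Liminf (at x within S) h)"

definition edom :: "('a \<Rightarrow> ereal) \<Rightarrow> 'a set" where
  "edom F = {x. F x < \<infinity>}"

definition grad :: "('a::real_inner \<Rightarrow> real) \<Rightarrow> 'a \<Rightarrow> 'a" where
  "grad f x = (THE g. gderiv f x g)"

definition continuously_differentiable :: "('a::real_inner \<Rightarrow> real) \<Rightarrow> bool" where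
  "continuously_differentiable f \<longleftrightarrow> (\<forall>x. \<exists>g. gderiv f x g) \<and> continuous_on UNIV (grad f)"

definition frechet_subdiff :: "('a::real_inner \<Rightarrow> ereal) \<Rightarrow> 'a \<Rightarrow> 'a set" where
  "frechet_subdiff F x = {g. x \<in> edom F \<and>
     0 \<le> Liminf (at x) (\<lambda>y. (F y - F x - ereal (inner g (y - x))) / ereal (norm (y - x)))}"

text \<open>
  No convergence \<open>F (x\<^sub>m) \<rightarrow> F x\<close> of the function values is required here, and \<open>x\<close> itself need not
  lie in \<open>edom F\<close>.
\<close>

definition limiting_subdiff :: "('a::real_inner \<Rightarrow> ereal) \<Rightarrow> 'a \<Rightarrow> 'a set" where
  "limiting_subdiff F x = {g. \<exists>xs gs. xs \<longlonglongrightarrow> x \<and> (\<forall>m::nat. gs m \<in> frechet_subdiff F (xs m)) \<and>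
     gs \<longlonglongrightarrow> g}"

definition dom_subdiff :: "('a::real_inner \<Rightarrow> ereal) \<Rightarrow> 'a set" where
  "dom_subdiff F = {x. limiting_subdiff F x \<noteq> {}}"

text \<open>
  \<open>infdist\<close> is the distance to the subdifferential; it is only used at points of \<open>dom_subdiff \<psi>\<close>,
  so its value \<open>0\<close> for the empty set plays no role, and since the limiting subdifferential is closed
  the infimum is attained in finite dimension.
\<close>

definition KL_property ::
    "('a::euclidean_space \<Rightarrow> ereal) \<Rightarrow> 'a \<Rightarrow> real \<Rightarrow> real \<Rightarrow> real \<Rightarrow> bool" where
  "KL_property \<psi> xbar \<rho> \<eta> \<theta> \<longleftrightarrow>
     xbar \<in> dom_subdiff \<psi> \<and> \<rho> > 0 \<and> \<eta> > 0 \<and> 0 \<le> \<theta> \<and> \<theta> < 1 \<and>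
     (\<exists>c>0. \<forall>x \<in> ball xbar \<rho> \<inter> dom_subdiff \<psi>.
        \<psi> xbar < \<psi> x \<and> \<psi> x < \<psi> xbar + ereal \<eta> \<longrightarrow>
        deriv (\<lambda>a. c * a powr (1 - \<theta>)) (real_of_ereal \<bar>\<psi> x - \<psi> xbar\<bar>)
          * infdist 0 (limiting_subdiff \<psi> x) \<ge> 1)"


section \<open>The block prox-linear method\<close>

text \<open>
  \<open>b k\<close> is the block picked at iteration \<open>k = 1, 2, \<dots>\<close> (the value \<open>b 0\<close> is irrelevant).
  \<open>prev_block \<beta> b x i k\<close> is the extrapolation point \<open>x\<^sub>i\<^sup>p\<^sup>r\<^sup>e\<^sup>v\<close> used at iteration \<open>k\<close>: the value of
  block \<open>i\<close> just before its most recent update prior to iteration \<open>k\<close>.  If there was none, it is the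
  block of \<open>x\<^sup>-\<^sup>1 = x\<^sup>0\<close>.
\<close>

definition prev_block ::
    "('n \<Rightarrow> 's) \<Rightarrow> (nat \<Rightarrow> 's) \<Rightarrow> (nat \<Rightarrow> real ^ 'n) \<Rightarrow> 's \<Rightarrow> nat \<Rightarrow> real ^ 'n" where
  "prev_block \<beta> b x i k =
     (if \<exists>m\<in>{1..<k}. b m = i then block \<beta> i (x (Max {m\<in>{1..<k}. b m = i} - 1))
      else block \<beta> i (x 0))"

definition extrapolated_block ::
    "('n \<Rightarrow> 's) \<Rightarrow> (nat \<Rightarrow> 's) \<Rightarrow> (nat \<Rightarrow> real) \<Rightarrow> (nat \<Rightarrow> real ^ 'n) \<Rightarrow> nat \<Rightarrow> real ^ 'n" where
  "extrapolated_block \<beta> b \<omega> x k =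
     (let i = b k in
      block \<beta> i (x (k - 1)) + \<omega> k *\<^sub>R (block \<beta> i (x (k - 1)) - prev_block \<beta> b x i k))"

definition BPL_iterates ::
    "('n \<Rightarrow> 's::finite) \<Rightarrow> (real ^ 'n \<Rightarrow> real) \<Rightarrow> ('s \<Rightarrow> real ^ 'n \<Rightarrow> ereal) \<Rightarrow>
     (nat \<Rightarrow> 's) \<Rightarrow> (nat \<Rightarrow> real) \<Rightarrow> (nat \<Rightarrow> real) \<Rightarrow> (nat \<Rightarrow> real ^ 'n) \<Rightarrow> bool" where
  "BPL_iterates \<beta> f r b \<alpha> \<omega> x \<longleftrightarrow>
     (\<forall>k\<ge>1.
        (\<forall>i. i \<noteq> b k \<longrightarrow> block \<beta> i (x k) = block \<beta> i (x (k - 1))) \<and>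
        (let i = b k; xhat = extrapolated_block \<beta> b \<omega> x k in
           is_arg_min
             (\<lambda>u. ereal (inner (block \<beta> i (grad f (replace_block \<beta> i (x (k - 1)) xhat))) (u - xhat)
                         + 1 / (2 * \<alpha> k) * (norm (u - xhat))\<^sup>2) + r i u)
             (\<lambda>u. u \<in> block_space \<beta> i)
             (block \<beta> i (x k))))"

text \<open>
  \<open>update_time b i j\<close> is the iteration at which block \<open>i\<close> is updated for the \<open>j\<close>-th time
  (\<open>j \<ge> 1\<close>), meaningful when block \<open>i\<close> is updated infinitely often.
\<close>

definition update_time :: "(nat \<Rightarrow> 's) \<Rightarrow> 's \<Rightarrow> nat \<Rightarrow> nat" where
  "update_time b i j = enumerate {k. 1 \<le> k \<and> b k = i} (j - 1)"

definition L_tilde :: "(nat \<Rightarrow> 's) \<Rightarrow> ('s \<Rightarrow> real) \<Rightarrow> (nat \<Rightarrow> real) \<Rightarrow> 's \<Rightarrow> nat \<Rightarrow> real" where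
  "L_tilde b L0 L i j = (if j = 0 then L0 i else L (update_time b i j))"

definition omega_tilde :: "(nat \<Rightarrow> 's) \<Rightarrow> (nat \<Rightarrow> real) \<Rightarrow> 's \<Rightarrow> nat \<Rightarrow> real" where
  "omega_tilde b \<omega> i j = \<omega> (update_time b i j)"

definition assumption1 ::
    "('n \<Rightarrow> 's::finite) \<Rightarrow> (real ^ 'n \<Rightarrow> real) \<Rightarrow> ('s \<Rightarrow> real ^ 'n \<Rightarrow> ereal) \<Rightarrow> bool" where
  "assumption1 \<beta> f r \<longleftrightarrow>
     continuously_differentiable f \<and>
     (\<forall>i. proper_on (block_space \<beta> i) (r i) \<and> lsc_on (block_space \<beta> i) (r i)) \<and>
     proper_on UNIV (objective \<beta> f r) \<and>
     (\<exists>m::real. \<forall>x \<in> edom (objective \<beta> f r). ereal m \<le> objective \<beta> f r x) \<and>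
     (\<exists>xstar. 0 \<in> limiting_subdiff (objective \<beta> f r) xstar)"

text \<open>The constants \<open>L k\<close> are given Lipschitz constants, not necessarily the smallest ones.\<close>

definition assumption2 ::
    "('n::finite \<Rightarrow> 's) \<Rightarrow> (real ^ 'n \<Rightarrow> real) \<Rightarrow> (nat \<Rightarrow> 's) \<Rightarrow> (nat \<Rightarrow> real ^ 'n) \<Rightarrow>
     (nat \<Rightarrow> real) \<Rightarrow> bool" where
  "assumption2 \<beta> f b x L \<longleftrightarrow>
     (\<forall>k\<ge>1. (L k)-lipschitz_on (block_space \<beta> (b k))
               (\<lambda>u. block \<beta> (b k) (grad f (replace_block \<beta> (b k) (x (k - 1)) u)))) \<and>
     (\<exists>l Lmax. 0 < l \<and> (\<forall>k\<ge>1. l \<le> L k \<and> L k \<le> Lmax))"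

definition assumption3 :: "(nat \<Rightarrow> 's) \<Rightarrow> bool" where
  "assumption3 b \<longleftrightarrow> (\<exists>T::nat. \<forall>k\<ge>1. \<forall>i. \<exists>m\<in>{k..<k + T}. b m = i)"

definition parameter_choice ::
    "(nat \<Rightarrow> 's) \<Rightarrow> ('s \<Rightarrow> real) \<Rightarrow> (nat \<Rightarrow> real) \<Rightarrow> (nat \<Rightarrow> real) \<Rightarrow> (nat \<Rightarrow> real) \<Rightarrow> bool" where
  "parameter_choice b L0 L \<alpha> \<omega> \<longleftrightarrow>
     (\<forall>k\<ge>1. \<alpha> k = 1 / (2 * L k)) \<and>
     (\<forall>k\<ge>1. 0 \<le> \<omega> k \<and> \<omega> k \<le> 1) \<and>
     (\<forall>i. L0 i > 0) \<and>
     (\<exists>\<delta>. 0 \<le> \<delta> \<and> \<delta> < 1 \<and>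
        (\<forall>i. \<forall>j\<ge>1. omega_tilde b \<omega> i j
            \<le> \<delta> / 6 * sqrt (L_tilde b L0 L i (j - 1) / L_tilde b L0 L i j)))"

end

theory Submission
  imports Defs
begin

text \<open>
  Let \<open>D k\<close> be the length of step \<open>k\<close> and \<open>W k = L k * (D k)\<^sup>2\<close>. Since \<open>\<alpha> k = 1 / (2 * L k)\<close>, optimality of the
  subproblem, the descent lemma and Young's inequality give
  \<open>4 * (F (x (k - 1)) - F (x k)) \<ge> W k - \<delta>\<^sup>2 * W m\<close>, with \<open>m\<close> the previous update of the same block.
  Let \<open>P k\<close> be the sum over the blocks of the value of \<open>W\<close> at their last update. Then the right-hand side is
  \<open>(1 - \<delta>\<^sup>2) * W k + \<delta>\<^sup>2 * (P k - P (k - 1))\<close>, which telescopes although the blocks are visited in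
  an irregular order. A window of \<open>T\<close> iterations contains the last update of every block, so \<open>P k\<close> is at most
  the sum \<open>Q k\<close> of \<open>W\<close> over the last window, and \<open>(A k)\<^sup>2 = (1 - \<delta>\<^sup>2) * Q k + \<delta>\<^sup>2 * P k\<close> satisfies
  \<open>(A (k + T))\<^sup>2 \<le> \<delta>\<^sup>2 * (A k)\<^sup>2 + 4 * (F (x k) - F (x (k + T)))\<close>.

  Adding up the optimality conditions of the last updates of all blocks yields a Frechet subgradient
  at \<open>x k\<close> whose norm is bounded by the path length over two windows, hence by a multiple of
  \<open>A k + A (k - T)\<close>. With the KL inequality and the concavity of \<open>\<phi> a = c * a powr (1 - \<theta>)\<close> this turns the
  recursion into \<open>A (k + T) \<le> \<delta> * A k + \<epsilon> * (A k + A (k - T)) + (U k - U (k + T))\<close>, where \<open>U\<close> is a multiple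
  of \<open>\<phi> (F (x k) - F xbar)\<close>. So the path length of the iterates that start near \<open>xbar\<close> is small, they never
  leave a small ball around \<open>xbar\<close>, and the KL inequality remains applicable.
\<close>


section \<open>Blocks\<close>

lemma block_nth [simp]: "block \<beta> i x $ j = (if \<beta> j = i then x $ j else 0)"
  by (simp add: block_def)

lemma linear_block: "linear (block \<beta> i)"
  by (rule linearI) (auto simp: vec_eq_iff)

lemmas block_add = linear_add[OF linear_block]
  and block_diff = linear_diff[OF linear_block]
  and block_scaleR = linear_scale[OF linear_block]

lemma block_in_space [simp]: "block \<beta> i x \<in> block_space \<beta> i"
  by (auto simp: block_space_def)

lemma block_space_eq_range: "block_space \<beta> i = range (block \<beta> i)"
proof -
  have "u = block \<beta> i u" if "u \<in> block_space \<beta> i" for u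
    using that by (auto simp: block_space_def vec_eq_iff)
  then show ?thesis by auto
qed

lemma block_idem [simp]: "block \<beta> i (block \<beta> i x) = block \<beta> i x"
  by (auto simp: vec_eq_iff)

lemma block_eq_self: "u \<in> block_space \<beta> i \<Longrightarrow> block \<beta> i u = u"
  by (auto simp: block_space_eq_range)

lemma subspace_block_space: "subspace (block_space \<beta> i)"
  unfolding block_space_eq_range by (intro linear_subspace_image linear_block subspace_UNIV)

lemma sum_block: "(\<Sum>i\<in>UNIV. block \<beta> i x) = x" for \<beta> :: "'n::finite \<Rightarrow> 's::finite"
  by (simp add: vec_eq_iff)

lemma inner_block: "inner (block \<beta> i x) y = inner x (block \<beta> i y)"
  by (auto simp: inner_vec_def intro!: sum.cong)

lemma norm_block_le: "norm (block \<beta> i x) \<le> norm x"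
  by (intro norm_le_componentwise_cart) auto

lemma tendsto_block [tendsto_intros]:
  "(g \<longlongrightarrow> a) F \<Longrightarrow> ((\<lambda>y. block \<beta> i (g y)) \<longlongrightarrow> block \<beta> i a) F"
  by (rule bounded_linear.tendsto[OF linear_conv_bounded_linear[THEN iffD1, OF linear_block]])

lemma replace_block_eq:
  "u \<in> block_space \<beta> i \<Longrightarrow> replace_block \<beta> i x u = x + (u - block \<beta> i x)"
  by (auto simp: replace_block_def block_space_def vec_eq_iff)


section \<open>Auxiliary inequalities\<close>

lemma gderiv_unique:
  assumes "gderiv f x g" "gderiv f x h"
  shows "g = h"
proof -
  have "(\<lambda>v. inner v g) = (\<lambda>v. inner v h)"
    using assms has_derivative_unique unfolding gderiv_def by blast
  then have "inner (g - h) (g - h) = 0"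
    by (metis inner_diff_right right_minus_eq)
  then show ?thesis by simp
qed

lemma gderiv_grad: "continuously_differentiable f \<Longrightarrow> gderiv f x (grad f x)"
  unfolding continuously_differentiable_def grad_def
  by (metis gderiv_unique theI')

text \<open>The difference \<open>g\<close> between \<open>f\<close> on the segment and its
  quadratic model has nonpositive derivative. The hypothesis concerns the direction \<open>v\<close>
  alone, so a Lipschitz condition on a single block suffices when \<open>v\<close> lies in that
  block.\<close>

lemma gradient_descent_bound:
  fixes f :: "'a::real_inner \<Rightarrow> real"
  assumes df: "\<And>y. gderiv f y (grad f y)"
    and lip: "\<And>t. 0 \<le> t \<Longrightarrow> t \<le> 1 \<Longrightarrow>
      inner v (grad f (a + t *\<^sub>R v) - grad f a) \<le> K * t * (norm v)\<^sup>2"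
  shows "f (a + v) \<le> f a + inner v (grad f a) + K / 2 * (norm v)\<^sup>2"
proof -
  define g where "g t = f (a + t *\<^sub>R v) - t * inner v (grad f a) - K / 2 * t\<^sup>2 * (norm v)\<^sup>2" for t
  have "(g has_real_derivative
      (inner v (grad f (a + t *\<^sub>R v)) - inner v (grad f a) - K * t * (norm v)\<^sup>2)) (at t)" for t
  proof -
    have 1: "((\<lambda>t. a + t *\<^sub>R v) has_derivative (\<lambda>h. h *\<^sub>R v)) (at t)"
      by (auto intro!: derivative_eq_intros)
    have 2: "(f has_derivative (\<lambda>h. inner h (grad f (a + t *\<^sub>R v)))) (at (a + t *\<^sub>R v))"
      using df unfolding gderiv_def .
    have "((\<lambda>t. f (a + t *\<^sub>R v)) has_derivative (\<lambda>h. inner (h *\<^sub>R v) (grad f (a + t *\<^sub>R v)))) (at t)"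
      using has_derivative_compose[OF 1 2] .
    then have "((\<lambda>t. f (a + t *\<^sub>R v)) has_real_derivative inner v (grad f (a + t *\<^sub>R v))) (at t)"
      by (simp add: has_field_derivative_def mult_commute_abs)
    then show ?thesis unfolding g_def
      by (auto intro!: derivative_eq_intros simp: power2_eq_square)
  qed
  moreover have "inner v (grad f (a + t *\<^sub>R v)) - inner v (grad f a) - K * t * (norm v)\<^sup>2 \<le> 0"
    if "0 \<le> t" "t \<le> 1" for t
    using lip[OF that] by (simp add: inner_diff_right)
  ultimately have "g 1 \<le> g 0"
    by (intro DERIV_nonpos_imp_nonincreasing[of 0 1 g] exI conjI) (rule zero_le_one)
  then show ?thesis by (simp add: g_def)
qed

text \<open>Concavity in tangent-line form, derived from Young's inequality for
  \<open>b powr p * a powr (1 - p)\<close>; this requires \<open>b > 0\<close>, hence the separate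
  case \<open>b = 0\<close>.\<close>

lemma powr_diff_ge:
  fixes a b p :: real
  assumes "0 < a" "0 \<le> b" "0 \<le> p" "p \<le> 1"
  shows "p * a powr (p - 1) * (a - b) \<le> a powr p - b powr p"
proof (cases "b = 0")
  case True
  have "p * a powr (p - 1) * a = p * a powr p"
    using assms by (simp add: powr_diff)
  also have "\<dots> \<le> a powr p"
    using assms by (simp add: mult_left_le_one_le)
  finally show ?thesis using True by simp
next
  case False
  then have "b > 0" using assms by simp
  have "b powr p * a powr (1 - p) \<le> p * b + (1 - p) * a"
    using Youngs_inequality_0[of p "1 - p" b a] assms \<open>b > 0\<close> by simp
  then have "b powr p * a powr (1 - p) * a powr (p - 1) \<le> (p * b + (1 - p) * a) * a powr (p - 1)"
    by (intro mult_right_mono) auto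
  also have "\<dots> = a * a powr (p - 1) - p * a powr (p - 1) * (a - b)"
    by (simp add: algebra_simps)
  also have "a * a powr (p - 1) = a powr p"
    using assms by (simp add: powr_diff)
  also have "b powr p * a powr (1 - p) * a powr (p - 1) = b powr p"
    using assms by (simp add: mult.assoc flip: powr_add)
  finally show ?thesis by simp
qed

text \<open>The product \<open>4 * C * s * d\<close> is at most the square of
  \<open>e * s + C / e * d\<close>, and a sum of two squares of nonnegative numbers is at most the
  square of their sum.\<close>

lemma le_of_square_recursion:
  fixes a z s :: real
  assumes "z\<^sup>2 \<le> \<delta>\<^sup>2 * a\<^sup>2 + 4 * C * s * d" "0 < e" "0 \<le> \<delta>" "0 \<le> a" "0 \<le> s" "0 \<le> C" "0 \<le> d"
  shows "z \<le> \<delta> * a + e * s + C / e * d"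
proof (rule power2_le_imp_le)
  define q where "q = e * s + C / e * d"
  have q: "0 \<le> q" unfolding q_def using assms by (auto intro!: add_nonneg_nonneg mult_nonneg_nonneg)
  have "q\<^sup>2 - (e * s - C / e * d)\<^sup>2 = 4 * ((e * s) * (C / e * d))"
    unfolding q_def by (simp only: power2_sum power2_diff) simp
  also have "(e * s) * (C / e * d) = C * s * d" using \<open>0 < e\<close> by simp
  finally have "4 * C * s * d = q\<^sup>2 - (e * s - C / e * d)\<^sup>2" by simp
  then have "4 * C * s * d \<le> q\<^sup>2" by (simp add: power2_eq_square)
  then have "z\<^sup>2 \<le> (\<delta> * a)\<^sup>2 + q\<^sup>2" using assms(1) by (simp add: power_mult_distrib)
  also have "\<dots> \<le> (\<delta> * a + q)\<^sup>2"
    using assms q by (simp add: power2_sum)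
  finally show "z\<^sup>2 \<le> (\<delta> * a + e * s + C / e * d)\<^sup>2" by (simp add: q_def add.assoc)
  show "0 \<le> \<delta> * a + e * s + C / e * d" using q assms by (simp add: q_def add.assoc)
qed

lemma sum_le_sqrt_card_sum_squares:
  fixes d :: "'a \<Rightarrow> real"
  shows "(\<Sum>i\<in>I. d i) \<le> sqrt (card I * (\<Sum>i\<in>I. (d i)\<^sup>2))"
proof -
  have "(\<Sum>i\<in>I. d i)\<^sup>2 \<le> (\<Sum>i\<in>I. 1) * (\<Sum>i\<in>I. (d i)\<^sup>2)"
    using Cauchy_Schwarz_ineq_sum[of "\<lambda>_. 1" d I] by simp
  then show ?thesis by (intro real_le_rsqrt) simp
qed

text \<open>The quadratic error divided by \<open>norm (y - x)\<close> still vanishes at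
  \<open>x\<close>, so the liminf does not see it. Constant sequences turn the Frechet subgradient
  into a limiting one.\<close>

lemma subgradient_of_quadratic_minorant:
  fixes F :: "'a::real_inner \<Rightarrow> ereal"
  assumes F: "F x = ereal c" and f: "gderiv f x h"
    and minorant: "\<And>y. F y \<ge> ereal (c + f y - f x + inner q (y - x) - K * (norm (y - x))\<^sup>2)"
  shows "h + q \<in> limiting_subdiff F x"
proof -
  have "h + q \<in> frechet_subdiff F x"
    unfolding frechet_subdiff_def mem_Collect_eq le_Liminf_iff
  proof (intro conjI allI impI)
    show "x \<in> edom F" using F by (simp add: edom_def)
    fix z :: ereal assume "z < 0"
    \<comment> \<open>Of the slack \<open>2 * e\<close>, one half absorbs the differentiability
      remainder of \<open>f\<close>, the other half the quadratic error.\<close>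
    then obtain e where e: "0 < e" "z < ereal (- 2 * e)"
    proof -
      obtain w where w: "z < ereal w" "ereal w < 0"
        using ereal_dense2[OF \<open>z < 0\<close>] by auto
      then show ?thesis by (intro that[of "- w / 2"]) auto
    qed
    have "((\<lambda>y. (f y - f x - inner (y - x) h) / norm (y - x)) \<longlongrightarrow> 0) (at x)"
      using f unfolding gderiv_def has_derivative_iff_norm
      by (subst tendsto_norm_zero_iff[symmetric]) (simp add: abs_divide)
    then have 1: "\<forall>\<^sub>F y in at x. \<bar>(f y - f x - inner (y - x) h) / norm (y - x)\<bar> < e"
      using e(1) by (auto simp: tendsto_iff)
    have "((\<lambda>y. \<bar>K\<bar> * norm (y - x)) \<longlongrightarrow> \<bar>K\<bar> * norm (x - x)) (at x)"
      by (intro tendsto_intros)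
    then have 2: "\<forall>\<^sub>F y in at x. \<bar>K\<bar> * norm (y - x) < e"
      using e(1) order_tendstoD(2) by fastforce
    have 3: "\<forall>\<^sub>F y in at x. y \<noteq> x" by (simp add: eventually_at_filter)
    show "\<forall>\<^sub>F y in at x. z < (F y - F x - ereal (inner (h + q) (y - x))) / ereal (norm (y - x))"
      using 1 2 3
    proof eventually_elim
      case (elim y)
      have n: "norm (y - x) > 0" using elim by simp
      have "K * (norm (y - x))\<^sup>2 / norm (y - x) \<le> \<bar>K\<bar> * norm (y - x)"
        using n by (simp add: power2_eq_square mult_right_mono)
      then have "- 2 * e \<le> (f y - f x - inner (y - x) h) / norm (y - x)
          - K * (norm (y - x))\<^sup>2 / norm (y - x)"
        using elim by linarith
      also have "\<dots> = (c + f y - f x + inner q (y - x) - K * (norm (y - x))\<^sup>2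
          - c - inner (h + q) (y - x)) / norm (y - x)"
        by (simp add: diff_divide_distrib add_divide_distrib inner_add_left inner_commute[of _ h])
      finally have "ereal (- 2 * e) \<le> (ereal (c + f y - f x + inner q (y - x) - K * (norm (y - x))\<^sup>2)
          - F x - ereal (inner (h + q) (y - x))) / ereal (norm (y - x))"
        using n by (simp add: F)
      also have "\<dots> \<le> (F y - F x - ereal (inner (h + q) (y - x))) / ereal (norm (y - x))"
        using n minorant[of y] by (intro ereal_divide_right_mono ereal_minus_mono) auto
      finally show ?case using e(2) by order
    qed
  qed
  then show ?thesis unfolding limiting_subdiff_def by force
qed

text \<open>For \<open>k \<ge> n\<close> the window sum consists of \<open>n\<close> shifted copies
  of \<open>a\<close>; smaller \<open>k\<close> are excluded because natural subtraction
  truncates.\<close>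

lemma tendsto_window_sum_0:
  fixes a :: "nat \<Rightarrow> real"
  assumes "a \<longlonglongrightarrow> 0"
  shows "(\<lambda>k. \<Sum>t\<in>{k - n<..k}. a t) \<longlonglongrightarrow> 0"
proof -
  have "(\<lambda>k. a (k - j)) \<longlonglongrightarrow> 0" for j
    using filterlim_compose[OF assms filterlim_minus_const_nat_at_top] .
  then have "(\<lambda>k. \<Sum>j<n. a (k - j)) \<longlonglongrightarrow> (\<Sum>j<n. 0)"
    by (intro tendsto_sum)
  moreover have "\<forall>\<^sub>F k in sequentially. (\<Sum>j<n. a (k - j)) = (\<Sum>t\<in>{k - n<..k}. a t)"
    using eventually_ge_at_top[of n]
  proof eventually_elim
    case (elim k)
    then show ?case
      by (intro sum.reindex_bij_witness[of _ "\<lambda>t. k - t" "\<lambda>j. k - j"]) auto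
  qed
  ultimately show ?thesis by (simp add: tendsto_cong)
qed

text \<open>\<open>lsc_on\<close> speaks of punctured neighbourhoods; \<open>c < h u\<close> adds
  the point \<open>u\<close> itself, so \<open>v\<close> may take the value
  \<open>u\<close>.\<close>

lemma lsc_on_eventually:
  assumes "lsc_on S h" "u \<in> S" "c < h u" "(v \<longlongrightarrow> u) G" "\<forall>\<^sub>F n in G. v n \<in> S"
  shows "\<forall>\<^sub>F n in G. c < h (v n)"
proof -
  have "\<forall>\<^sub>F y in at u within S. c < h y"
    using assms(1-3) unfolding lsc_on_def le_Liminf_iff by blast
  then have "\<forall>\<^sub>F y in nhds u. y \<in> S \<longrightarrow> c < h y"
    unfolding eventually_at_filter by (rule eventually_mono) (use assms(3) in auto)
  then have "\<forall>\<^sub>F n in G. v n \<in> S \<longrightarrow> c < h (v n)"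
    using assms(4) by (rule eventually_compose_filterlim)
  then show ?thesis using assms(5) by eventually_elim simp
qed


section \<open>The parameter choice in terms of iteration numbers\<close>

text \<open>Two updates of a block with no update between them are neighbours in the enumeration of
  its update times. This replaces the count of updates per block by iteration numbers.\<close>

lemma parameter_choice_consecutive:
  assumes "parameter_choice b L0 L \<alpha> \<omega>" and inf: "\<And>i. infinite {k. 1 \<le> k \<and> b k = i}"
  obtains \<delta> where "0 \<le> \<delta>" "\<delta> < 1"
    "\<And>m k. 1 \<le> m \<Longrightarrow> m < k \<Longrightarrow> b m = b k \<Longrightarrow> \<forall>t\<in>{m<..<k}. b t \<noteq> b k \<Longrightarrow>
      \<omega> k \<le> \<delta> / 6 * sqrt (L m / L k)"
proof -
  obtain \<delta> where \<delta>: "0 \<le> \<delta>" "\<delta> < 1"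
    and w: "\<And>i j. j \<ge> 1 \<Longrightarrow> omega_tilde b \<omega> i j
            \<le> \<delta> / 6 * sqrt (L_tilde b L0 L i (j - 1) / L_tilde b L0 L i j)"
    using assms(1) unfolding parameter_choice_def by blast
  have "\<omega> k \<le> \<delta> / 6 * sqrt (L m / L k)"
    if "1 \<le> m" "m < k" "b m = b k" and gap: "\<forall>t\<in>{m<..<k}. b t \<noteq> b k" for m k
  proof -
    define S where "S = {t. 1 \<le> t \<and> b t = b k}"
    have S: "infinite S" "m \<in> S" "k \<in> S" using inf that unfolding S_def by auto
    obtain c d where cd: "enumerate S c = m" "enumerate S d = k"
      using S enumerate_Ex by metis
    have "c < d" using that(2) S(1) by (simp flip: cd)
    have "\<not> Suc c < d"
    proof
      assume "Suc c < d"
      then have "enumerate S (Suc c) \<in> {m<..<k}"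
        using S(1) by (simp flip: cd)
      moreover have "enumerate S (Suc c) \<in> S" by (intro enumerate_in_set S)
      ultimately show False using gap by (auto simp: S_def)
    qed
    with \<open>c < d\<close> have "d = Suc c" by simp
    \<comment> \<open>The \<open>j\<close>-th update has enumeration index \<open>j - 1\<close>, so
      \<open>k\<close> belongs to \<open>j = Suc d\<close>. Then \<open>j - 1 = Suc c\<close> is
      positive, and \<open>L_tilde\<close> returns \<open>L m\<close> rather than the initial
      \<open>L0\<close>.\<close>
    then show ?thesis
      using w[of "Suc d" "b k", unfolded omega_tilde_def L_tilde_def update_time_def, folded S_def] cd
      by simp
  qed
  then show ?thesis using \<delta> that by blast
qed


section \<open>Descent\<close>

locale block_prox_linear =
  fixes \<beta> :: "'n::finite \<Rightarrow> 's::finite"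
    and f :: "real ^ 'n \<Rightarrow> real"
    and r :: "'s \<Rightarrow> real ^ 'n \<Rightarrow> ereal"
    and b :: "nat \<Rightarrow> 's"
    and L \<alpha> \<omega> :: "nat \<Rightarrow> real"
    and x :: "nat \<Rightarrow> real ^ 'n"
    and T :: nat
    and l M \<delta> :: real
  assumes gderiv_f: "gderiv f y (grad f y)"
    and continuous_grad: "continuous_on UNIV (grad f)"
    and r_proper: "proper_on (block_space \<beta> i) (r i)"
    and r_lsc: "lsc_on (block_space \<beta> i) (r i)"
    and lipschitz: "k \<ge> 1 \<Longrightarrow> (L k)-lipschitz_on (block_space \<beta> (b k))
      (\<lambda>u. block \<beta> (b k) (grad f (replace_block \<beta> (b k) (x (k - 1)) u)))"
    and l_pos: "0 < l"
    and l_le: "k \<ge> 1 \<Longrightarrow> l \<le> L k"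
    and le_M: "k \<ge> 1 \<Longrightarrow> L k \<le> M"
    and cover: "k \<ge> 1 \<Longrightarrow> \<exists>m\<in>{k..<k + T}. b m = i"
    and \<alpha>_eq: "k \<ge> 1 \<Longrightarrow> \<alpha> k = 1 / (2 * L k)"
    and \<omega>_nonneg: "k \<ge> 1 \<Longrightarrow> 0 \<le> \<omega> k"
    and \<omega>_le_1: "k \<ge> 1 \<Longrightarrow> \<omega> k \<le> 1"
    and \<delta>: "0 \<le> \<delta>" "\<delta> < 1"
    and weights: "1 \<le> m \<Longrightarrow> m < k \<Longrightarrow> b m = b k \<Longrightarrow> \<forall>t\<in>{m<..<k}. b t \<noteq> b k \<Longrightarrow>
      \<omega> k \<le> \<delta> / 6 * sqrt (L m / L k)"
    and iterates: "BPL_iterates \<beta> f r b \<alpha> \<omega> x"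
begin

section \<open>Extrapolation, step lengths and last updates of the blocks\<close>

abbreviation "F \<equiv> objective \<beta> f r"

text \<open>The extrapolation displacement as a vector of the full space, so that \<open>z k\<close>
  is the point at which iteration \<open>k\<close> evaluates the gradient.\<close>

definition "e k = \<omega> k *\<^sub>R (block \<beta> (b k) (x (k - 1)) - prev_block \<beta> b x (b k) k)"

definition "z k = x (k - 1) + e k"

definition "D k = norm (x k - x (k - 1))"

definition "W k = L k * (D k)\<^sup>2"

text \<open>\<open>w k i\<close> is the value of \<open>W\<close> at the last update of block \<open>i\<close> up to iteration \<open>k\<close>.\<close>

primrec w :: "nat \<Rightarrow> 's \<Rightarrow> real" where
  "w 0 = (\<lambda>i. 0)"
| "w (Suc k) = (w k)(b (Suc k) := W (Suc k))"

definition "P k = (\<Sum>i\<in>UNIV. w k i)"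

lemma L_pos: "k \<ge> 1 \<Longrightarrow> 0 < L k"
  using l_pos l_le by force

lemma T_pos: "0 < T"
  using cover[of 1] by fastforce

lemma D_nonneg: "0 \<le> D k"
  by (simp add: D_def)

lemma W_nonneg: "k \<ge> 1 \<Longrightarrow> 0 \<le> W k"
  using L_pos by (simp add: W_def less_imp_le)

lemma block_unchanged: "k \<ge> 1 \<Longrightarrow> i \<noteq> b k \<Longrightarrow> block \<beta> i (x k) = block \<beta> i (x (k - 1))"
  using iterates unfolding BPL_iterates_def by blast

lemma block_step: "k \<ge> 1 \<Longrightarrow> block \<beta> (b k) (x k - x (k - 1)) = x k - x (k - 1)"
proof -
  assume k: "k \<ge> 1"
  have "(x k - x (k - 1)) $ j = 0" if "\<beta> j \<noteq> b k" for j
    using block_unchanged[OF k that] by (metis block_nth right_minus_eq vector_minus_component)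
  then show ?thesis by (auto simp: vec_eq_iff)
qed

lemma block_constant:
  assumes "m \<le> k" "\<forall>t\<in>{m<..k}. b t \<noteq> i"
  shows "block \<beta> i (x k) = block \<beta> i (x m)"
  using assms
proof (induction k rule: dec_induct)
  case (step n)
  then show ?case using block_unchanged[of "Suc n" i] by force
qed simp

lemma w_eq:
  assumes "1 \<le> m" "m \<le> k" "b m = i" "\<forall>t\<in>{m<..k}. b t \<noteq> i"
  shows "w k i = W m"
  using assms(2,4)
proof (induction k rule: dec_induct)
  case base
  obtain m' where "m = Suc m'" using assms(1) by (cases m) auto
  then show ?case using assms(3) by auto
next
  case (step n)
  then show ?case by auto
qed

lemma w_nonneg: "0 \<le> w k i"
  by (induction k) (auto simp: W_nonneg)

lemma last_update_cases:
  obtains (none) "\<forall>t\<in>{1..k}. b t \<noteq> i"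
  | (last) m where "1 \<le> m" "m \<le> k" "b m = i" "\<forall>t\<in>{m<..k}. b t \<noteq> i"
proof (cases "\<exists>t\<in>{1..k}. b t = i")
  case True
  define m where "m = Max {t\<in>{1..k}. b t = i}"
  have "m \<in> {t\<in>{1..k}. b t = i}" unfolding m_def using True by (intro Max_in) auto
  moreover have "b t \<noteq> i" if "t \<in> {m<..k}" for t
  proof
    assume "b t = i"
    then have "t \<le> m" unfolding m_def using that calculation by (intro Max_ge) auto
    with that show False by simp
  qed
  ultimately show ?thesis using last by auto
next
  case False
  then show ?thesis using none by blast
qed

text \<open>For \<open>T \<le> k\<close> the window of the last \<open>T\<close> iterations starts
  at 1 or later, so it contains an update of every block.\<close>

lemma last_update:
  assumes "T \<le> k"
  obtains m where "1 \<le> m" "m \<le> k" "k < m + T" "b m = i" "\<forall>t\<in>{m<..k}. b t \<noteq> i"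
proof -
  obtain m0 where m0: "m0 \<in> {k + 1 - T..<k + 1 - T + T}" "b m0 = i"
    using cover[of "k + 1 - T" i] assms by (metis Suc_eq_plus1 Suc_diff_le diff_is_0_eq' not_less_eq_eq le_add2 plus_1_eq_Suc le_add1)
  then show ?thesis
  proof (cases rule: last_update_cases[of k i])
    case none
    then show ?thesis using m0 assms by auto
  next
    case (last m)
    then have "m0 \<le> m" using m0 assms by (metis add.commute atLeastLessThan_iff
          diff_add_inverse greaterThanAtMost_iff le_add_diff_inverse2 le_add1 less_Suc_eq_le
          linorder_not_less order_trans Suc_eq_plus1)
    then show ?thesis using last m0 that[of m] by auto
  qed
qed

lemma prev_block_last:
  assumes "1 \<le> m" "m < k" "b m = i" "\<forall>t\<in>{m<..<k}. b t \<noteq> i"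
  shows "prev_block \<beta> b x i k = block \<beta> i (x (m - 1))"
proof -
  have "Max {m\<in>{1..<k}. b m = i} = m"
    using assms by (intro Max_eqI) (auto simp: not_less[symmetric])
  moreover have "\<exists>m\<in>{1..<k}. b m = i" using assms(1-3) by (intro bexI[of _ m]) auto
  ultimately show ?thesis unfolding prev_block_def by (simp only: if_True)
qed

text \<open>Before the first update of a block its current and previous values both come from
  \<open>x 0\<close>, and the extrapolation vanishes for any weight. Otherwise it is a multiple of
  the block's last step.\<close>

lemma e_cases:
  assumes "k \<ge> 1"
  obtains (zero) "e k = 0"
  | (last) m where "1 \<le> m" "m < k" "k \<le> m + T" "b m = b k" "\<forall>t\<in>{m<..<k}. b t \<noteq> b k"
      "norm (e k) \<le> \<omega> k * D m"
proof (cases rule: last_update_cases[of "k - 1" "b k"])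
  case none
  then have "block \<beta> (b k) (x (k - 1)) = block \<beta> (b k) (x 0)"
    using block_constant[of 0 "k - 1" "b k"] by auto
  moreover have "prev_block \<beta> b x (b k) k = block \<beta> (b k) (x 0)"
    using none unfolding prev_block_def by auto
  ultimately show ?thesis using zero by (simp add: e_def)
next
  case (last m)
  have "m < k" using last assms by auto
  have gap: "\<forall>t\<in>{m<..<k}. b t \<noteq> b k" using last by auto
  \<comment> \<open>The next update after \<open>m\<close> comes no later than \<open>m + T\<close>,
    and it cannot come before \<open>k\<close>.\<close>
  have "\<exists>m'\<in>{m + 1..<m + 1 + T}. b m' = b k" by (rule cover) simp
  then obtain m' where "m' \<in> {m + 1..<m + 1 + T}" "b m' = b k" by blast
  then have "k \<le> m + T" using gap by (cases "m' < k") auto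
  have "block \<beta> (b k) (x (k - 1)) = block \<beta> (b k) (x m)"
    using block_constant last by simp
  moreover have "prev_block \<beta> b x (b k) k = block \<beta> (b k) (x (m - 1))"
    using prev_block_last last \<open>m < k\<close> gap by simp
  ultimately have "e k = \<omega> k *\<^sub>R block \<beta> (b k) (x m - x (m - 1))"
    by (simp add: e_def block_diff)
  then have "norm (e k) \<le> \<omega> k * D m"
    using \<omega>_nonneg[OF assms] by (simp add: D_def mult_left_mono norm_block_le)
  then show ?thesis
    using that(2)[OF \<open>1 \<le> m\<close> \<open>m < k\<close> \<open>k \<le> m + T\<close> \<open>b m = b k\<close> gap] by simp
qed

lemma e_in_block_space: "e k \<in> block_space \<beta> (b k)"
proof -
  have "e k = block \<beta> (b k) (e k)"
    unfolding e_def prev_block_def by (simp add: block_scaleR block_diff)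
  then show ?thesis by (metis block_in_space)
qed

text \<open>The square root in the weight bound trades \<open>L k\<close> for \<open>L m\<close>,
  and \<open>9 / 36 = 1 / 4\<close>. The factor 9 is the one that Young's inequality produces in
  \<open>descent\<close>.\<close>

lemma norm_e_sq_le:
  assumes "k \<ge> 1"
  shows "9 * L k * (norm (e k))\<^sup>2 \<le> \<delta>\<^sup>2 / 4 * w (k - 1) (b k)"
  using assms
proof (cases rule: e_cases)
  case zero
  then show ?thesis using w_nonneg by simp
next
  case (last m)
  have "w (k - 1) (b k) = W m"
    using last by (intro w_eq) auto
  have Lk: "L k > 0" "L m > 0" using L_pos assms last by auto
  have "(\<omega> k)\<^sup>2 \<le> (\<delta> / 6 * sqrt (L m / L k))\<^sup>2"
    using weights last \<omega>_nonneg[OF assms] by (intro power_mono) auto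
  also have "\<dots> = \<delta>\<^sup>2 / 36 * (L m / L k)"
    using Lk by (simp add: power_mult_distrib power_divide)
  finally have "L k * (\<omega> k)\<^sup>2 \<le> L k * (\<delta>\<^sup>2 / 36 * (L m / L k))"
    using Lk by (intro mult_left_mono) auto
  then have *: "9 * (L k * (\<omega> k)\<^sup>2) \<le> \<delta>\<^sup>2 / 4 * L m" using Lk by simp
  have "(norm (e k))\<^sup>2 \<le> (\<omega> k)\<^sup>2 * (D m)\<^sup>2"
    using last by (metis norm_ge_zero power_mono power_mult_distrib)
  then have "9 * L k * (norm (e k))\<^sup>2 \<le> 9 * L k * ((\<omega> k)\<^sup>2 * (D m)\<^sup>2)"
    using Lk by (intro mult_left_mono) auto
  also have "\<dots> = 9 * (L k * (\<omega> k)\<^sup>2) * (D m)\<^sup>2" by simp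
  also have "\<dots> \<le> \<delta>\<^sup>2 / 4 * L m * (D m)\<^sup>2"
    using * by (intro mult_right_mono) auto
  finally show ?thesis using \<open>w (k - 1) (b k) = W m\<close> by (simp add: W_def)
qed

section \<open>Optimality in the proximal subproblem\<close>

lemma block_prox_step: "k \<ge> 1 \<Longrightarrow> block \<beta> (b k) (x k - z k) = x k - z k"
  using block_step[of k] block_eq_self[OF e_in_block_space[of k]]
  by (simp add: z_def block_diff block_add algebra_simps)

text \<open>The optimality condition of the subproblem, with its quadratic model expanded around \<open>x k\<close>.\<close>

definition "q k = grad f (z k) + (2 * L k) *\<^sub>R (x k - z k)"

text \<open>The minimizer is compared with an arbitrary \<open>u\<close>. Descent takes the old
  block for \<open>u\<close>, subgradients need every \<open>u\<close>, and the limit point needs a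
  fixed \<open>u\<close>.\<close>

lemma r_minorant:
  assumes k: "k \<ge> 1" and u: "u \<in> block_space \<beta> (b k)"
  shows "r (b k) (block \<beta> (b k) (x k))
    \<le> r (b k) u + ereal (inner (q k) (u - block \<beta> (b k) (x k))
                        + L k * (norm (u - block \<beta> (b k) (x k)))\<^sup>2)"
proof -
  define i where "i = b k"
  define xhat where "xhat = block \<beta> i (z k)"
  define g where "g = grad f (z k)"
  define y where "y = block \<beta> i (x k)"
  have y: "y \<in> block_space \<beta> i" and xhat: "xhat \<in> block_space \<beta> i"
    by (simp_all add: y_def xhat_def)
  have hat: "extrapolated_block \<beta> b \<omega> x k = xhat"
    using block_eq_self[OF e_in_block_space[of k]]
    by (simp add: extrapolated_block_def Let_def xhat_def z_def e_def i_def block_add)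
  have rep: "replace_block \<beta> i (x (k - 1)) xhat = z k"
    unfolding replace_block_eq[OF xhat]
    by (simp add: xhat_def z_def i_def block_add block_eq_self[OF e_in_block_space[of k]])
  have inner_g: "inner (block \<beta> i g) (v - xhat) = inner g (v - xhat)" if "v \<in> block_space \<beta> i" for v
    using subspace_diff[OF subspace_block_space that xhat] block_eq_self
    by (metis inner_block)
  have "is_arg_min (\<lambda>u. ereal (inner (block \<beta> i g) (u - xhat)
          + 1 / (2 * \<alpha> k) * (norm (u - xhat))\<^sup>2) + r i u) (\<lambda>u. u \<in> block_space \<beta> i) y"
    using iterates[unfolded BPL_iterates_def Let_def, THEN spec, THEN mp, OF k, THEN conjunct2]
    by (simp only: hat rep y_def g_def flip: i_def)
  then have *: "ereal (inner g (y - xhat) + L k * (norm (y - xhat))\<^sup>2) + r i y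
      \<le> ereal (inner g (u - xhat) + L k * (norm (u - xhat))\<^sup>2) + r i u"
    using u L_pos[OF k] unfolding is_arg_min_def
    by (auto simp: \<alpha>_eq[OF k] inner_g y not_less simp flip: i_def)
  have "y - xhat = x k - z k"
    using block_prox_step[OF k] by (simp add: y_def xhat_def i_def block_diff)
  then have q: "inner (q k) (u - y) = inner g (u - y) + 2 * L k * inner (y - xhat) (u - y)"
    by (simp add: q_def g_def inner_add_left)
  have norm: "(norm (u - xhat))\<^sup>2
      = (norm (u - y))\<^sup>2 + 2 * inner (y - xhat) (u - y) + (norm (y - xhat))\<^sup>2"
    by (simp add: power2_norm_eq_inner inner_diff_left inner_diff_right inner_commute)
  have inner: "inner g (u - xhat) = inner g (y - xhat) + inner g (u - y)"
    by (simp add: inner_diff_right)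
  have "inner g (u - xhat) + L k * (norm (u - xhat))\<^sup>2
    = inner g (y - xhat) + L k * (norm (y - xhat))\<^sup>2 + (inner (q k) (u - y) + L k * (norm (u - y))\<^sup>2)"
    unfolding norm inner q by (simp add: distrib_left)
  \<comment> \<open>Only a common real summand is split off for cancellation, so
    \<open>r i u\<close> may be infinite.\<close>
  with * have "ereal (inner g (y - xhat) + L k * (norm (y - xhat))\<^sup>2) + r i y
      \<le> ereal (inner g (y - xhat) + L k * (norm (y - xhat))\<^sup>2)
        + (r i u + ereal (inner (q k) (u - y) + L k * (norm (u - y))\<^sup>2))"
    by (simp add: add.assoc add.commute add.left_commute flip: plus_ereal.simps(1))
  then show ?thesis
    by (simp add: i_def y_def ereal_add_le_add_iff)
qed

section \<open>The real-valued objective and descent in one iteration\<close>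

definition "R i y = real_of_ereal (r i (block \<beta> i y))"

text \<open>\<open>real_of_ereal\<close> sends infinity to 0, so \<open>\<Phi>\<close> represents
  \<open>F\<close> only at points where every \<open>r i\<close> is finite.\<close>

definition "\<Phi> y = f y + (\<Sum>i\<in>UNIV. R i y)"

lemma r_not_MInf: "u \<in> block_space \<beta> i \<Longrightarrow> r i u \<noteq> -\<infinity>"
  using r_proper unfolding proper_on_def by blast

lemma r_eq_R: "r i (block \<beta> i y) < \<infinity> \<Longrightarrow> r i (block \<beta> i y) = ereal (R i y)"
  using r_not_MInf[of "block \<beta> i y" i] by (auto simp: R_def ereal_real)

lemma F_eq_\<Phi>: "(\<And>i. r i (block \<beta> i y) < \<infinity>) \<Longrightarrow> F y = ereal (\<Phi> y)"
  by (simp add: objective_def r_eq_R \<Phi>_def)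

lemma r_finite_if: "F y < \<infinity> \<Longrightarrow> r i (block \<beta> i y) < \<infinity>"
  by (auto simp: objective_def sum_Pinfty less_top)

lemma r_finite_updated:
  assumes "k \<ge> 1"
  shows "r (b k) (block \<beta> (b k) (x k)) < \<infinity>"
proof -
  obtain u where u: "u \<in> block_space \<beta> (b k)" "r (b k) u < \<infinity>"
    using r_proper unfolding proper_on_def by blast
  then show ?thesis using r_minorant[OF assms u(1)] by auto
qed

text \<open>The starting point may lie outside the domain of \<open>F\<close>. After
  \<open>T\<close> iterations every block has been updated, and an updated block has a finite value
  of its \<open>r\<close>.\<close>

lemma F_iterate:
  assumes "T \<le> k"
  shows "F (x k) = ereal (\<Phi> (x k))"
proof (rule F_eq_\<Phi>)
  fix i
  obtain m where "1 \<le> m" "m \<le> k" "b m = i" "\<forall>t\<in>{m<..k}. b t \<noteq> i"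
    using last_update[OF assms] by metis
  then show "r i (block \<beta> i (x k)) < \<infinity>"
    using block_constant r_finite_updated by metis
qed

lemma descent:
  assumes "T < k"
  shows "4 * (\<Phi> (x (k - 1)) - \<Phi> (x k)) \<ge> W k - \<delta>\<^sup>2 * w (k - 1) (b k)"
proof -
  have k: "k \<ge> 1" using assms by simp
  define i where "i = b k"
  define v where "v = x k - x (k - 1)"
  have fin: "r j (block \<beta> j (x (k - 1))) = ereal (R j (x (k - 1)))" "r j (block \<beta> j (x k)) = ereal (R j (x k))" for j
    using assms F_iterate[of k] F_iterate[of "k - 1"] by (auto intro!: r_eq_R r_finite_if)
  have Rj: "R j (x k) = R j (x (k - 1))" if "j \<noteq> i" for j
    using that block_unchanged[OF k] by (simp add: R_def i_def)
  have bv: "block \<beta> i v = v" using block_step[OF k] by (simp add: v_def i_def)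
  have d: "block \<beta> i (x (k - 1)) - block \<beta> i (x k) = - v"
    using bv by (metis block_diff minus_diff_eq v_def)
  have xz: "x k - z k = v - e k" by (simp add: z_def v_def)
  have Lk: "0 < L k" using L_pos k by simp
  have "R i (x k) \<le> R i (x (k - 1)) + (inner (q k) (- v) + L k * (norm v)\<^sup>2)"
    using r_minorant[OF k, of "block \<beta> i (x (k - 1))"] by (simp add: i_def fin d[unfolded i_def] del: One_nat_def)
  then have 1: "R i (x k) \<le> R i (x (k - 1)) - inner (grad f (z k)) v - L k * (norm v)\<^sup>2 + 2 * L k * inner (e k) v"
    by (simp add: q_def xz inner_add_left inner_diff_left power2_norm_eq_inner algebra_simps)
  have lip: "norm (block \<beta> i (grad f (x (k - 1) + u)) - block \<beta> i (grad f (x (k - 1)))) \<le> L k * norm u"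
    if "u \<in> block_space \<beta> i" for u
  proof -
    define y where "y = block \<beta> i (x (k - 1))"
    have "y + u \<in> block_space \<beta> i" "y \<in> block_space \<beta> i"
      using that by (auto simp: y_def intro!: subspace_add[OF subspace_block_space])
    then show ?thesis
      using lipschitz_onD[OF lipschitz[OF k], of "y + u" y]
      by (simp add: dist_norm replace_block_eq i_def y_def)
  qed
  have "f (x (k - 1) + v) \<le> f (x (k - 1)) + inner v (grad f (x (k - 1))) + L k / 2 * (norm v)\<^sup>2"
  proof (rule gradient_descent_bound[OF gderiv_f])
    fix t :: real assume t: "0 \<le> t" "t \<le> 1"
    have "inner v (grad f (x (k - 1) + t *\<^sub>R v) - grad f (x (k - 1)))
      = inner v (block \<beta> i (grad f (x (k - 1) + t *\<^sub>R v)) - block \<beta> i (grad f (x (k - 1))))"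
      by (metis block_diff bv inner_block)
    also have "\<dots> \<le> norm v * (L k * norm (t *\<^sub>R v))"
      using bv by (intro order_trans[OF norm_cauchy_schwarz] mult_left_mono lip)
        (metis block_in_space subspace_scale subspace_block_space, simp)
    also have "\<dots> = L k * t * (norm v)\<^sup>2" using t by (simp add: power2_eq_square)
    finally show "inner v (grad f (x (k - 1) + t *\<^sub>R v) - grad f (x (k - 1))) \<le> L k * t * (norm v)\<^sup>2" .
  qed
  then have 2: "f (x k) \<le> f (x (k - 1)) + inner v (grad f (x (k - 1))) + L k / 2 * (norm v)\<^sup>2"
    by (simp add: v_def)
  have "inner v (grad f (x (k - 1)) - grad f (z k))
      = inner v (block \<beta> i (grad f (x (k - 1))) - block \<beta> i (grad f (z k)))"
    by (metis block_diff bv inner_block)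
  also have "\<dots> \<le> norm v * (L k * norm (e k))"
    using lip[of "e k"] e_in_block_space[of k]
    by (intro order_trans[OF norm_cauchy_schwarz] mult_left_mono) (auto simp: z_def i_def norm_minus_commute)
  finally have 3: "inner v (grad f (x (k - 1))) - inner (grad f (z k)) v \<le> L k * (norm (e k) * norm v)"
    by (simp add: inner_diff_right inner_commute mult_ac)
  have 4: "2 * L k * inner (e k) v \<le> 2 * L k * (norm (e k) * norm v)"
    using Lk by (intro mult_left_mono norm_cauchy_schwarz) auto
  \<comment> \<open>Young's inequality for the total cross term: one share comes from the gradient
    difference between \<open>x (k - 1)\<close> and \<open>z k\<close>, two from the proximal
    term.\<close>
  have "0 \<le> L k * (norm v / 2 - 3 * norm (e k))\<^sup>2" using Lk by simp
  then have 5: "3 * L k * (norm (e k) * norm v) \<le> L k * (norm v)\<^sup>2 / 4 + 9 * L k * (norm (e k))\<^sup>2"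
    by (simp add: power2_diff power_divide algebra_simps power_mult_distrib)
  have "(\<Sum>j\<in>UNIV. R j (x k)) - (\<Sum>j\<in>UNIV. R j (x (k - 1))) = (\<Sum>j\<in>{i}. R j (x k) - R j (x (k - 1)))"
    unfolding sum_subtractf[symmetric] by (rule sum.mono_neutral_right) (auto simp: Rj)
  then have "\<Phi> (x k) - \<Phi> (x (k - 1)) = f (x k) - f (x (k - 1)) + R i (x k) - R i (x (k - 1))"
    by (simp add: \<Phi>_def)
  also have "\<dots> \<le> - (L k * (norm v)\<^sup>2 / 4) + 9 * L k * (norm (e k))\<^sup>2"
    using 1 2 3 4 5 by linarith
  finally show ?thesis
    using norm_e_sq_le[OF k] by (simp add: W_def D_def v_def algebra_simps)
qed

section \<open>Telescoping with the potential \<open>P\<close>\<close>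

lemma P_step:
  assumes "k \<ge> 1"
  shows "P k = P (k - 1) - w (k - 1) (b k) + W k"
proof -
  obtain n where n: "k = Suc n" using assms by (cases k) auto
  have "P k - P n = (\<Sum>i\<in>UNIV. w k i - w n i)" by (simp add: P_def sum_subtractf)
  also have "\<dots> = (\<Sum>i\<in>{b k}. w k i - w n i)"
    by (rule sum.mono_neutral_right) (auto simp: n)
  finally show ?thesis by (simp add: n)
qed

lemma P_nonneg: "0 \<le> P k"
  unfolding P_def by (intro sum_nonneg w_nonneg)

lemma descent_P:
  assumes "T < k"
  shows "(1 - \<delta>\<^sup>2) * W k + \<delta>\<^sup>2 * (P k - P (k - 1)) \<le> 4 * (\<Phi> (x (k - 1)) - \<Phi> (x k))"
proof -
  have "P k - P (k - 1) = W k - w (k - 1) (b k)" using P_step assms by simp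
  moreover have "(1 - \<delta>\<^sup>2) * W k + \<delta>\<^sup>2 * (W k - w (k - 1) (b k)) = W k - \<delta>\<^sup>2 * w (k - 1) (b k)"
    by (simp add: algebra_simps)
  ultimately show ?thesis using descent[OF assms] by simp
qed

lemma descent_sum:
  assumes "T \<le> k"
  shows "(1 - \<delta>\<^sup>2) * (\<Sum>t\<in>{k<..k + n}. W t) + \<delta>\<^sup>2 * (P (k + n) - P k)
    \<le> 4 * (\<Phi> (x k) - \<Phi> (x (k + n)))"
proof (induction n)
  case (Suc n)
  have "{k<..k + Suc n} = insert (k + Suc n) {k<..k + n}" by auto
  then show ?case using Suc descent_P[of "k + Suc n"] assms by (simp add: algebra_simps)
qed simp

lemma P_le_window:
  assumes "T \<le> k"
  shows "P k \<le> (\<Sum>t\<in>{k - T<..k}. W t)"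
proof -
  have "\<exists>m. m \<in> {k - T<..k} \<and> b m = i \<and> w k i = W m" for i
  proof -
    obtain m where "1 \<le> m" "m \<le> k" "k < m + T" "b m = i" "\<forall>t\<in>{m<..k}. b t \<noteq> i"
      using last_update[OF assms] by metis
    then show ?thesis using w_eq assms by (intro exI[of _ m]) auto
  qed
  then obtain m where m: "\<And>i. m i \<in> {k - T<..k}" "\<And>i. b (m i) = i" "\<And>i. w k i = W (m i)"
    by metis
  \<comment> \<open>Different blocks have different last update times, so \<open>P k\<close> is a
    subsum of the window sum.\<close>
  have "inj m" using m(2) by (metis injI)
  have "P k = (\<Sum>t\<in>range m. W t)"
    unfolding P_def m(3) using \<open>inj m\<close> by (subst sum.reindex) auto
  also have "\<dots> \<le> (\<Sum>t\<in>{k - T<..k}. W t)"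
    using m(1) by (intro sum_mono2) (auto simp: W_nonneg)
  finally show ?thesis .
qed


section \<open>Subgradients at the iterates\<close>

text \<open>Two windows are needed: the last update of a block lies in the last one, and its
  extrapolation refers to an update up to \<open>T\<close> iterations earlier.\<close>

definition "S k = (\<Sum>t\<in>{k - 2 * T<..k}. D t)"

definition "Q k = (\<Sum>t\<in>{k - T<..k}. W t)"

definition "A k = sqrt ((1 - \<delta>\<^sup>2) * Q k + \<delta>\<^sup>2 * P k)"

text \<open>The constant by which \<open>A\<close> controls the path length over one window.\<close>

definition "B = sqrt (T / (l * (1 - \<delta>\<^sup>2)))"

lemma \<delta>_sq: "\<delta>\<^sup>2 < 1"
  using \<delta> by (simp add: power_less_one_iff abs_less_iff)

lemma S_nonneg: "0 \<le> S k"
  unfolding S_def by (intro sum_nonneg D_nonneg)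

lemma Q_nonneg: "0 \<le> Q k"
  unfolding Q_def by (intro sum_nonneg W_nonneg) auto

lemma A_nonneg: "0 \<le> A k"
  using \<delta>_sq Q_nonneg P_nonneg by (simp add: A_def)

lemma A_sq: "(A k)\<^sup>2 = (1 - \<delta>\<^sup>2) * Q k + \<delta>\<^sup>2 * P k"
  using \<delta>_sq Q_nonneg P_nonneg by (simp add: A_def)

lemma norm_iterates_diff_le: "m \<le> k \<Longrightarrow> norm (x k - x m) \<le> (\<Sum>t\<in>{m<..k}. D t)"
proof (induction k rule: dec_induct)
  case (step k)
  have "norm (x (Suc k) - x m) \<le> D (Suc k) + norm (x k - x m)"
    unfolding D_def using norm_triangle_ineq[of "x (Suc k) - x k" "x k - x m"] by simp
  moreover have "{m<..Suc k} = insert (Suc k) {m<..k}" using step by auto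
  ultimately show ?case using step by simp
qed simp

text \<open>The extrapolation at \<open>m\<close> is at most the step of the preceding update
  \<open>m'\<close> because \<open>\<omega> m \<le> 1\<close>. The indices \<open>m'\<close>,
  \<open>m\<close> and those after \<open>m\<close> are distinct and lie in the double
  window.\<close>

lemma norm_prox_step_le:
  assumes "1 \<le> m" "m \<le> k" "k < m + T" "2 * T \<le> k"
  shows "norm (x k - z m) \<le> S k" "norm (x m - z m) \<le> S k"
proof -
  have xz: "norm (x m - z m) \<le> D m + norm (e m)"
    unfolding D_def z_def by (metis diff_diff_add norm_triangle_ineq4)
  have *: "(\<Sum>t\<in>{m<..k}. D t) + (D m + norm (e m)) \<le> S k"
    using assms(1)
  proof (cases rule: e_cases)
    case zero
    have "(\<Sum>t\<in>{m<..k}. D t) + D m = (\<Sum>t\<in>insert m {m<..k}. D t)" by simp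
    also have "\<dots> \<le> S k"
      unfolding S_def using assms by (intro sum_mono2 D_nonneg) auto
    finally show ?thesis using zero by simp
  next
    case (last m')
    have "\<omega> m * D m' \<le> D m'"
      using \<omega>_le_1[OF assms(1)] \<omega>_nonneg[OF assms(1)] D_nonneg by (intro mult_left_le_one_le)
    then have "(\<Sum>t\<in>{m<..k}. D t) + (D m + norm (e m)) \<le> (\<Sum>t\<in>insert m' (insert m {m<..k}). D t)"
      using last by auto
    also have "\<dots> \<le> S k"
      unfolding S_def using assms last by (intro sum_mono2 D_nonneg) auto
    finally show ?thesis .
  qed
  have "0 \<le> (\<Sum>t\<in>{m<..k}. D t)" by (intro sum_nonneg D_nonneg)
  then show "norm (x m - z m) \<le> S k" using xz * by linarith
  have "norm (x k - z m) \<le> norm (x k - x m) + norm (x m - z m)"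
    using norm_triangle_ineq[of "x k - x m" "x m - z m"] by simp
  then show "norm (x k - z m) \<le> S k" using norm_iterates_diff_le[OF assms(2)] xz * by linarith
qed

text \<open>A block still has the value of its last update, so the bounds of
  \<open>r_minorant\<close> from different iterations all hold at \<open>x k\<close>. They add up to
  one quadratic minorant of \<open>F\<close>.\<close>

lemma subgradient:
  assumes "T \<le> k"
    and m: "\<And>i. 1 \<le> m i" "\<And>i. m i \<le> k" "\<And>i. b (m i) = i" "\<And>i. \<forall>t\<in>{m i<..k}. b t \<noteq> i"
  shows "(\<Sum>i\<in>UNIV. block \<beta> i (grad f (x k) - q (m i))) \<in> limiting_subdiff F (x k)"
proof -
  define v where "v = (\<Sum>i\<in>UNIV. - block \<beta> i (q (m i)))"
  have fin: "r i (block \<beta> i (x k)) = ereal (R i (x k))" for i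
    using F_iterate[OF assms(1)] by (auto intro!: r_eq_R r_finite_if)
  have lower: "ereal (R i (x k) - inner (block \<beta> i (q (m i))) (y - x k) - M * (norm (y - x k))\<^sup>2)
      \<le> r i (block \<beta> i y)" for i y
  proof (cases "r i (block \<beta> i y) < \<infinity>")
    case True
    then have y: "r i (block \<beta> i y) = ereal (R i y)" by (rule r_eq_R)
    have "block \<beta> i (x (m i)) = block \<beta> i (x k)"
      using block_constant m by metis
    then have "R i (x k) \<le> R i y + (inner (q (m i)) (block \<beta> i (y - x k))
        + L (m i) * (norm (block \<beta> i (y - x k)))\<^sup>2)"
      using r_minorant[OF m(1), of "block \<beta> i y" i] m(3)[of i] by (simp add: fin y block_diff)
    moreover have "L (m i) * (norm (block \<beta> i (y - x k)))\<^sup>2 \<le> M * (norm (y - x k))\<^sup>2"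
      using le_M[OF m(1)] L_pos[OF m(1), of i]
      by (intro mult_mono power_mono norm_block_le) (auto intro: order_trans[OF less_imp_le])
    ultimately show ?thesis by (simp add: y inner_block)
  qed auto
  have "grad f (x k) + v \<in> limiting_subdiff F (x k)"
  proof (rule subgradient_of_quadratic_minorant[where F = F and x = "x k", OF F_iterate[OF assms(1)] gderiv_f])
    fix y
    have "ereal (\<Phi> (x k) + f y - f (x k) + inner v (y - x k) - (CARD('s) * M) * (norm (y - x k))\<^sup>2)
      = ereal (f y) + (\<Sum>i\<in>UNIV. ereal (R i (x k) - inner (block \<beta> i (q (m i))) (y - x k)
          - M * (norm (y - x k))\<^sup>2))"
      by (simp add: \<Phi>_def v_def sum_subtractf inner_sum_left sum_negf mult.assoc)
    also have "\<dots> \<le> F y"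
      unfolding objective_def by (intro add_left_mono sum_mono lower)
    finally show "ereal (\<Phi> (x k) + f y - f (x k) + inner v (y - x k)
      - (CARD('s) * M) * (norm (y - x k))\<^sup>2) \<le> F y" .
  qed
  also have "grad f (x k) + v = (\<Sum>i\<in>UNIV. block \<beta> i (grad f (x k) - q (m i)))"
    by (simp add: v_def block_diff sum_subtractf sum_negf sum_block)
  finally show ?thesis .
qed

lemma subgradient_bound:
  assumes "2 * T \<le> k" "x k \<in> ball xbar \<rho>" "S k < \<rho>"
    and lip: "\<And>i. LG-lipschitz_on (ball xbar (4 * \<rho>)) (\<lambda>y. block \<beta> i (grad f y))"
  obtains g where "g \<in> limiting_subdiff F (x k)" "norm g \<le> CARD('s) * (LG + 2 * M) * S k"
proof -
  have "T \<le> k" using assms by simp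
  then have "\<exists>m. 1 \<le> m \<and> m \<le> k \<and> k < m + T \<and> b m = i \<and> (\<forall>t\<in>{m<..k}. b t \<noteq> i)" for i
    using last_update by metis
  then obtain m where m: "\<And>i. 1 \<le> m i" "\<And>i. m i \<le> k" "\<And>i. k < m i + T" "\<And>i. b (m i) = i"
    "\<And>i. \<forall>t\<in>{m i<..k}. b t \<noteq> i" by metis
  have "norm (block \<beta> i (grad f (x k) - q (m i))) \<le> (LG + 2 * M) * S k" for i
  proof -
    note near = norm_prox_step_le[OF m(1,2,3) assms(1), of i]
    have "\<rho> > 0" using assms(3) S_nonneg[of k] by linarith
    \<comment> \<open>Both distances on the right are below \<open>\<rho>\<close>, which leaves
      \<open>z (m i)\<close> inside the ball of the Lipschitz condition.\<close>
    have "dist xbar (z (m i)) \<le> dist xbar (x k) + norm (x k - z (m i))"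
      by (metis dist_norm dist_triangle)
    then have "z (m i) \<in> ball xbar (4 * \<rho>)" "x k \<in> ball xbar (4 * \<rho>)"
      using near assms(2,3) \<open>\<rho> > 0\<close> by auto
    then have "norm (block \<beta> i (grad f (x k)) - block \<beta> i (grad f (z (m i)))) \<le> LG * norm (x k - z (m i))"
      using lipschitz_onD[OF lip, of "x k" "z (m i)"] by (simp add: dist_norm)
    also have "\<dots> \<le> LG * S k" using near lipschitz_on_nonneg[OF lip] by (intro mult_left_mono) auto
    finally have 1: "norm (block \<beta> i (grad f (x k) - grad f (z (m i)))) \<le> LG * S k"
      by (simp add: block_diff)
    have "norm (block \<beta> i ((2 * L (m i)) *\<^sub>R (x (m i) - z (m i)))) \<le> 2 * L (m i) * norm (x (m i) - z (m i))"
      using L_pos[OF m(1), of i] norm_block_le[of \<beta> i "(2 * L (m i)) *\<^sub>R (x (m i) - z (m i))"] by simp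
    also have "\<dots> \<le> 2 * M * S k"
      using L_pos[OF m(1), of i] le_M[OF m(1), of i] near by (intro mult_mono) auto
    finally have 2: "norm (block \<beta> i ((2 * L (m i)) *\<^sub>R (x (m i) - z (m i)))) \<le> 2 * M * S k" .
    have "block \<beta> i (grad f (x k) - q (m i)) = block \<beta> i (grad f (x k) - grad f (z (m i)))
        - block \<beta> i ((2 * L (m i)) *\<^sub>R (x (m i) - z (m i)))"
      by (simp add: q_def block_diff block_add)
    then have "norm (block \<beta> i (grad f (x k) - q (m i))) \<le> LG * S k + 2 * M * S k"
      using add_mono[OF 1 2] by (simp only: order_trans[OF norm_triangle_ineq4])
    then show ?thesis by (simp add: distrib_right)
  qed
  then have "norm (\<Sum>i\<in>UNIV. block \<beta> i (grad f (x k) - q (m i))) \<le> CARD('s) * ((LG + 2 * M) * S k)"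
    by (intro sum_norm_bound)
  then show ?thesis
    using that[OF subgradient[OF \<open>T \<le> k\<close> m(1,2,4,5)]] by (simp add: mult.assoc)
qed


section \<open>Energy over windows of length \<open>T\<close>\<close>

text \<open>Cauchy-Schwarz over \<open>T\<close> steps, with
  \<open>l * (D t)\<^sup>2 \<le> W t\<close> and
  \<open>(1 - \<delta>\<^sup>2) * Q k \<le> (A k)\<^sup>2\<close>.\<close>

lemma window_sum_le:
  assumes "T \<le> k"
  shows "(\<Sum>t\<in>{k - T<..k}. D t) \<le> B * A k"
proof -
  have "(D t)\<^sup>2 \<le> W t / l" if "t \<in> {k - T<..k}" for t
    using that assms l_pos l_le[of t] unfolding W_def by (simp add: field_simps mult_right_mono)
  then have "(\<Sum>t\<in>{k - T<..k}. (D t)\<^sup>2) \<le> Q k / l"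
    unfolding Q_def sum_divide_distrib by (intro sum_mono)
  also have "Q k \<le> (A k)\<^sup>2 / (1 - \<delta>\<^sup>2)"
    using \<delta>_sq P_nonneg[of k] by (simp add: A_sq field_simps)
  then have "Q k / l \<le> (A k)\<^sup>2 / (1 - \<delta>\<^sup>2) / l"
    using l_pos by (intro divide_right_mono) auto
  finally have "T * (\<Sum>t\<in>{k - T<..k}. (D t)\<^sup>2) \<le> T * ((A k)\<^sup>2 / (1 - \<delta>\<^sup>2) / l)"
    by (intro mult_left_mono) auto
  also have "\<dots> = T / (l * (1 - \<delta>\<^sup>2)) * (A k)\<^sup>2" by (simp add: mult.commute)
  finally have "sqrt (T * (\<Sum>t\<in>{k - T<..k}. (D t)\<^sup>2)) \<le> sqrt (T / (l * (1 - \<delta>\<^sup>2)) * (A k)\<^sup>2)"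
    by (rule real_sqrt_le_mono)
  also have "\<dots> = B * A k" using A_nonneg by (simp only: B_def real_sqrt_mult real_sqrt_abs abs_of_nonneg)
  finally show ?thesis
    using sum_le_sqrt_card_sum_squares[of D "{k - T<..k}"] assms by simp
qed

lemma S_le:
  assumes "2 * T \<le> k"
  shows "S k \<le> B * (A k + A (k - T))"
proof -
  have "{k - 2 * T<..k} = {k - T - T<..k - T} \<union> {k - T<..k}"
    using assms by auto
  then have "S k = (\<Sum>t\<in>{k - T - T<..k - T}. D t) + (\<Sum>t\<in>{k - T<..k}. D t)"
    unfolding S_def by (simp add: sum.union_disjoint disjoint_iff)
  then show ?thesis
    using window_sum_le[of k] window_sum_le[of "k - T"] assms
    unfolding distrib_left by linarith
qed

text \<open>\<open>(A k)\<^sup>2\<close> is a convex combination of \<open>Q k\<close> and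
  \<open>P k\<close>, and \<open>P k \<le> Q k\<close>, so it dominates \<open>P k\<close>, the term
  left over by the telescoped descent.\<close>

lemma A_sq_step:
  assumes "T \<le> k"
  shows "(A (k + T))\<^sup>2 \<le> \<delta>\<^sup>2 * (A k)\<^sup>2 + 4 * (\<Phi> (x k) - \<Phi> (x (k + T)))"
proof -
  have "(1 - \<delta>\<^sup>2) * P k \<le> (1 - \<delta>\<^sup>2) * Q k"
    unfolding Q_def using \<delta>_sq by (intro mult_left_mono P_le_window assms) auto
  then have "P k \<le> (A k)\<^sup>2" unfolding A_sq by (simp add: algebra_simps)
  then have "\<delta>\<^sup>2 * P k \<le> \<delta>\<^sup>2 * (A k)\<^sup>2" by (intro mult_left_mono) auto
  then show ?thesis
    using descent_sum[OF assms, of T] unfolding A_sq[of "k + T"] Q_def by (simp add: right_diff_distrib)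
qed

text \<open>Telescoped descent against a lower bound of the objective makes \<open>W\<close>
  summable.\<close>

lemma W_tendsto_0:
  assumes "\<And>k. T \<le> k \<Longrightarrow> c \<le> \<Phi> (x k)"
  shows "W \<longlonglongrightarrow> 0"
proof -
  have "(\<Sum>i<n. W (i + (T + 1))) \<le> (4 * (\<Phi> (x T) - c) + \<delta>\<^sup>2 * P T) / (1 - \<delta>\<^sup>2)" for n
  proof -
    have "(\<Sum>i<n. W (i + (T + 1))) = (\<Sum>t\<in>{T<..T + n}. W t)"
      by (intro sum.reindex_bij_witness[of _ "\<lambda>t. t - (T + 1)" "\<lambda>i. i + (T + 1)"]) auto
    moreover have "0 \<le> \<delta>\<^sup>2 * P (T + n)" using P_nonneg by simp
    moreover have "c \<le> \<Phi> (x (T + n))" using assms by simp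
    ultimately have "(1 - \<delta>\<^sup>2) * (\<Sum>i<n. W (i + (T + 1))) \<le> 4 * (\<Phi> (x T) - c) + \<delta>\<^sup>2 * P T"
      using descent_sum[of T n] by (simp add: right_diff_distrib)
    then show ?thesis using \<delta>_sq by (simp add: pos_le_divide_eq mult.commute)
  qed
  then have "summable (\<lambda>i. W (i + (T + 1)))"
    by (intro summableI_nonneg_bounded) (auto intro: W_nonneg)
  then show ?thesis by (metis LIMSEQ_offset summable_LIMSEQ_zero)
qed

lemma D_tendsto_0:
  assumes "W \<longlonglongrightarrow> 0"
  shows "D \<longlonglongrightarrow> 0"
proof -
  have "(\<lambda>k. sqrt (W k / l)) \<longlonglongrightarrow> sqrt (0 / l)"
    using l_pos by (intro tendsto_intros assms) auto
  moreover have "\<forall>\<^sub>F k in sequentially. D k \<le> sqrt (W k / l)"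
    using eventually_ge_at_top[of 1]
  proof eventually_elim
    case (elim k)
    then have "l * (D k)\<^sup>2 \<le> W k" unfolding W_def by (intro mult_right_mono l_le) auto
    then show ?case using l_pos by (intro real_le_rsqrt) (simp add: field_simps)
  qed
  ultimately show ?thesis
    by (intro tendsto_sandwich[of "\<lambda>_. 0" D _ "\<lambda>k. sqrt (W k / l)"]) (auto simp: D_nonneg)
qed

lemma S_tendsto_0: "W \<longlonglongrightarrow> 0 \<Longrightarrow> S \<longlonglongrightarrow> 0"
  using tendsto_window_sum_0[OF D_tendsto_0, of "2 * T"] by (simp add: S_def[abs_def])

lemma A_tendsto_0:
  assumes "W \<longlonglongrightarrow> 0"
  shows "A \<longlonglongrightarrow> 0"
proof -
  have Q: "Q \<longlonglongrightarrow> 0"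
    using tendsto_window_sum_0[OF assms, of T] by (simp add: Q_def[abs_def])
  have "\<forall>\<^sub>F k in sequentially. P k \<le> Q k"
    using eventually_ge_at_top[of T] by eventually_elim (simp add: Q_def P_le_window)
  then have "P \<longlonglongrightarrow> 0"
    by (intro tendsto_sandwich[OF _ _ tendsto_const Q]) (auto simp: P_nonneg)
  then have "(\<lambda>k. sqrt ((1 - \<delta>\<^sup>2) * Q k + \<delta>\<^sup>2 * P k)) \<longlonglongrightarrow> sqrt ((1 - \<delta>\<^sup>2) * 0 + \<delta>\<^sup>2 * 0)"
    by (intro tendsto_intros Q)
  then show ?thesis by (simp add: A_def[abs_def])
qed

end


section \<open>Convergence\<close>

locale block_prox_linear_KL = block_prox_linear \<beta> f r b L \<alpha> \<omega> x T l M \<delta>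
  for \<beta> :: "'n::finite \<Rightarrow> 's::finite" and f r b L \<alpha> \<omega> x T l M \<delta> +
  fixes xbar :: "real ^ 'n" and \<phi> :: "nat \<Rightarrow> nat" and \<rho> \<eta> \<theta> c LG lower :: real
  assumes monotone: "k \<ge> 1 \<Longrightarrow> F (x k) \<le> F (x (k - 1))"
    and bounded_below: "y \<in> edom F \<Longrightarrow> ereal lower \<le> F y"
    and \<phi>_at_top: "filterlim \<phi> at_top sequentially"
    and \<phi>_ge: "2 * T \<le> \<phi> n"
    and subsequence: "(\<lambda>n. x (\<phi> n)) \<longlonglongrightarrow> xbar"
    and \<rho>_pos: "0 < \<rho>" and \<eta>_pos: "0 < \<eta>" and \<theta>: "0 \<le> \<theta>" "\<theta> < 1" and c_pos: "0 < c"
    and KL: "y \<in> ball xbar \<rho> \<Longrightarrow> y \<in> dom_subdiff F \<Longrightarrow> F xbar < F y \<Longrightarrow> F y < F xbar + ereal \<eta> \<Longrightarrow>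
      1 \<le> deriv (\<lambda>a. c * a powr (1 - \<theta>)) (real_of_ereal \<bar>F y - F xbar\<bar>) * infdist 0 (limiting_subdiff F y)"
    and local_lipschitz: "LG-lipschitz_on (ball xbar (4 * \<rho>)) (\<lambda>y. block \<beta> i (grad f y))"
begin

section \<open>Objective values along the convergent subsequence\<close>

lemma \<phi>_ge_T: "T \<le> \<phi> n"
  using \<phi>_ge[of n] by linarith

lemma \<Phi>_decreasing:
  assumes "T \<le> j" "j \<le> k"
  shows "\<Phi> (x k) \<le> \<Phi> (x j)"
  using assms(2)
proof (induction k rule: dec_induct)
  case (step k)
  then show ?case using monotone[of "Suc k"] F_iterate[of k] F_iterate[of "Suc k"] assms(1) by simp
qed simp

lemma lower_le_\<Phi>: "T \<le> k \<Longrightarrow> lower \<le> \<Phi> (x k)"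
  using bounded_below[of "x k"] by (simp add: F_iterate edom_def)

lemma W_vanishes: "W \<longlonglongrightarrow> 0"
  using lower_le_\<Phi> by (rule W_tendsto_0)

lemma S_\<phi>_tendsto_0: "(\<lambda>n. S (\<phi> n)) \<longlonglongrightarrow> 0"
  by (rule filterlim_compose[OF S_tendsto_0[OF W_vanishes] \<phi>_at_top])

text \<open>At the last update of block \<open>i\<close>, \<open>u\<close> competes with the block
  of \<open>x (\<phi> n)\<close>. The points \<open>z (m n)\<close> converge to \<open>xbar\<close>
  with the subsequence, hence \<open>q (m n)\<close> to \<open>grad f xbar\<close>.\<close>

lemma R_upper_bound:
  assumes u: "u \<in> block_space \<beta> i" "r i u = ereal a"
  obtains G where "\<And>n. R i (x (\<phi> n)) \<le> a + G n"
    "G \<longlonglongrightarrow> inner (grad f xbar) (u - block \<beta> i xbar) + M * (norm (u - block \<beta> i xbar))\<^sup>2"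
proof -
  have "\<exists>m. 1 \<le> m \<and> m \<le> \<phi> n \<and> \<phi> n < m + T \<and> b m = i \<and> (\<forall>t\<in>{m<..\<phi> n}. b t \<noteq> i)" for n
    using last_update[OF \<phi>_ge_T] by metis
  then obtain m where m: "\<And>n. 1 \<le> m n" "\<And>n. m n \<le> \<phi> n" "\<And>n. \<phi> n < m n + T" "\<And>n. b (m n) = i"
    "\<And>n. \<forall>t\<in>{m n<..\<phi> n}. b t \<noteq> i" by metis
  note near = norm_prox_step_le[OF m(1,2,3) \<phi>_ge]
  have "(\<lambda>n. x (\<phi> n) - z (m n)) \<longlonglongrightarrow> 0"
    by (rule Lim_null_comparison[OF _ S_\<phi>_tendsto_0]) (simp add: near)
  from tendsto_diff[OF subsequence this] have "(\<lambda>n. z (m n)) \<longlonglongrightarrow> xbar" by simp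
  then have grad: "(\<lambda>n. grad f (z (m n))) \<longlonglongrightarrow> grad f xbar"
    using continuous_grad by (intro isCont_tendsto_compose[of xbar "grad f"])
      (auto simp: continuous_on_eq_continuous_at)
  have bound: "norm ((2 * L (m n)) *\<^sub>R (x (m n) - z (m n))) \<le> 2 * M * S (\<phi> n)" for n
    unfolding norm_scaleR
    using L_pos[OF m(1), of n] le_M[OF m(1), of n] near[of n] by (intro mult_mono) auto
  have "(\<lambda>n. 2 * M * S (\<phi> n)) \<longlonglongrightarrow> 2 * M * 0"
    by (intro tendsto_intros S_\<phi>_tendsto_0)
  then have "(\<lambda>n. 2 * M * S (\<phi> n)) \<longlonglongrightarrow> 0" by (simp only: mult_zero_right)
  then have "(\<lambda>n. (2 * L (m n)) *\<^sub>R (x (m n) - z (m n))) \<longlonglongrightarrow> 0"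
    by (rule Lim_null_comparison[OF always_eventually[OF allI[OF bound]]])
  from tendsto_add[OF grad this] have q: "(\<lambda>n. q (m n)) \<longlonglongrightarrow> grad f xbar"
    by (simp add: q_def)
  define G where "G n = inner (q (m n)) (u - block \<beta> i (x (\<phi> n)))
    + M * (norm (u - block \<beta> i (x (\<phi> n))))\<^sup>2" for n
  show ?thesis
  proof (rule that[of G])
    show "G \<longlonglongrightarrow> inner (grad f xbar) (u - block \<beta> i xbar) + M * (norm (u - block \<beta> i xbar))\<^sup>2"
      unfolding G_def by (intro tendsto_intros q subsequence)
    fix n
    have "block \<beta> i (x (m n)) = block \<beta> i (x (\<phi> n))" using block_constant m by metis
    moreover have "r i (block \<beta> i (x (\<phi> n))) = ereal (R i (x (\<phi> n)))"
      using F_iterate[OF \<phi>_ge_T] by (auto intro!: r_eq_R r_finite_if)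
    ultimately have "R i (x (\<phi> n)) \<le> a + (inner (q (m n)) (u - block \<beta> i (x (\<phi> n)))
        + L (m n) * (norm (u - block \<beta> i (x (\<phi> n))))\<^sup>2)"
      using r_minorant[OF m(1), of u n] u by (simp add: m(4))
    also have "\<dots> \<le> a + G n"
      unfolding G_def using le_M[OF m(1)] by (intro add_left_mono mult_right_mono) auto
    finally show "R i (x (\<phi> n)) \<le> a + G n" .
  qed
qed

lemma R_eventually_gt:
  assumes "ereal a < r i (block \<beta> i xbar)"
  shows "\<forall>\<^sub>F n in sequentially. a < R i (x (\<phi> n))"
proof -
  have "\<forall>\<^sub>F n in sequentially. ereal a < r i (block \<beta> i (x (\<phi> n)))"
    by (rule lsc_on_eventually[OF r_lsc block_in_space assms tendsto_block[OF subsequence]]) simp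
  moreover have "r i (block \<beta> i (x (\<phi> n))) = ereal (R i (x (\<phi> n)))" for n
    using F_iterate[OF \<phi>_ge_T] by (auto intro!: r_eq_R r_finite_if)
  ultimately show ?thesis by simp
qed

text \<open>An infinite value would, by lower semicontinuity, drive \<open>R i\<close> above every
  bound along the subsequence, whereas a competitor with finite value keeps it bounded.\<close>

lemma r_xbar_finite: "r i (block \<beta> i xbar) < \<infinity>"
proof (rule ccontr)
  assume inf: "\<not> ?thesis"
  obtain u where u: "u \<in> block_space \<beta> i" "r i u < \<infinity>"
    using r_proper unfolding proper_on_def by blast
  then obtain a where "r i u = ereal a"
    using r_not_MInf[OF u(1)] by (cases "r i u") auto
  then obtain G g where G: "\<And>n. R i (x (\<phi> n)) \<le> a + G n" "G \<longlonglongrightarrow> g"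
    using R_upper_bound[OF u(1)] by metis
  have "\<forall>\<^sub>F n in sequentially. G n < g + 1" using order_tendstoD(2)[OF G(2)] by simp
  moreover have "\<forall>\<^sub>F n in sequentially. a + g + 1 < R i (x (\<phi> n))"
    using inf by (intro R_eventually_gt) auto
  ultimately have "\<forall>\<^sub>F n in sequentially. False"
  proof eventually_elim
    case (elim n)
    then show ?case using G(1)[of n] by linarith
  qed
  then show False by simp
qed

text \<open>Lower semicontinuity gives the lower half. The competitor
  \<open>block \<beta> i xbar\<close> gives the upper half, since its error term tends to 0.\<close>

lemma R_tendsto: "(\<lambda>n. R i (x (\<phi> n))) \<longlonglongrightarrow> R i xbar"
proof (rule order_tendstoI)
  fix a assume "a < R i xbar"
  then show "\<forall>\<^sub>F n in sequentially. a < R i (x (\<phi> n))"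
    by (intro R_eventually_gt) (simp add: r_eq_R[OF r_xbar_finite])
next
  fix a assume a: "R i xbar < a"
  obtain G where G: "\<And>n. R i (x (\<phi> n)) \<le> R i xbar + G n" "G \<longlonglongrightarrow> 0"
    using R_upper_bound[OF block_in_space r_eq_R[OF r_xbar_finite]] by auto
  then have "\<forall>\<^sub>F n in sequentially. G n < a - R i xbar"
    using a by (intro order_tendstoD(2)[OF G(2)]) simp
  then show "\<forall>\<^sub>F n in sequentially. R i (x (\<phi> n)) < a"
  proof eventually_elim
    case (elim n)
    then show ?case using G(1)[of n] by linarith
  qed
qed

lemma \<Phi>_tendsto: "(\<lambda>n. \<Phi> (x (\<phi> n))) \<longlonglongrightarrow> \<Phi> xbar"
proof -
  have "isCont f xbar" using gderiv_f has_derivative_continuous unfolding gderiv_def by blast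
  then show ?thesis
    unfolding \<Phi>_def by (intro tendsto_intros R_tendsto isCont_tendsto_compose[OF _ subsequence])
qed

lemma \<Phi>_xbar_le:
  assumes "T \<le> k"
  shows "\<Phi> xbar \<le> \<Phi> (x k)"
proof (rule tendsto_upperbound[OF \<Phi>_tendsto])
  have "\<forall>\<^sub>F n in sequentially. k \<le> \<phi> n" using \<phi>_at_top by (simp add: filterlim_at_top)
  then show "\<forall>\<^sub>F n in sequentially. \<Phi> (x (\<phi> n)) \<le> \<Phi> (x k)"
    by eventually_elim (rule \<Phi>_decreasing[OF assms])
qed simp

section \<open>The KL inequality and the linear recursion for \<open>A\<close>\<close>

definition "C = CARD('s) * (LG + 2 * M)"

lemma C_nonneg: "0 \<le> C"
proof -
  have "0 \<le> M" using L_pos[of 1] le_M[of 1] by simp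
  moreover have "0 \<le> LG" using lipschitz_on_nonneg[OF local_lipschitz] .
  ultimately show ?thesis by (simp add: C_def)
qed

definition "gap k = \<Phi> (x k) - \<Phi> xbar"

lemma KL_step:
  assumes "2 * T \<le> k" "x k \<in> ball xbar \<rho>" "S k < \<rho>" "0 < gap k" "gap k < \<eta>"
  shows "1 \<le> c * ((1 - \<theta>) * gap k powr (- \<theta>)) * (C * S k)"
proof -
  obtain g where g: "g \<in> limiting_subdiff F (x k)" "norm g \<le> C * S k"
    using subgradient_bound[OF assms(1-3) local_lipschitz] unfolding C_def by metis
  have F: "F (x k) = ereal (\<Phi> (x k))" "F xbar = ereal (\<Phi> xbar)"
    using F_iterate assms(1) F_eq_\<Phi>[OF r_xbar_finite] by auto
  have "x k \<in> dom_subdiff F" using g by (auto simp: dom_subdiff_def)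
  then have "1 \<le> deriv (\<lambda>a. c * a powr (1 - \<theta>)) (gap k) * infdist 0 (limiting_subdiff F (x k))"
    using KL[of "x k"] assms(2,4,5) by (simp add: F gap_def)
  also have "deriv (\<lambda>a. c * a powr (1 - \<theta>)) (gap k) = c * ((1 - \<theta>) * gap k powr (- \<theta>))"
    using DERIV_cmult[OF has_real_derivative_powr[OF assms(4), of "1 - \<theta>"], of c]
    by (intro DERIV_imp_deriv) simp
  also have "\<dots> * infdist 0 (limiting_subdiff F (x k)) \<le> c * ((1 - \<theta>) * gap k powr (- \<theta>)) * (C * S k)"
    using g infdist_le[OF g(1), of 0] c_pos \<theta> by (intro mult_left_mono) auto
  finally show ?thesis .
qed

text \<open>
  \<open>\<epsilon>\<close> is the weight in Young's inequality; it is small enough that the coefficients \<open>\<delta> + \<epsilon>\<close> and \<open>\<epsilon>\<close>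
  of the resulting two-term recursion sum to less than \<open>1\<close>.
\<close>

definition "\<epsilon> = (1 - \<delta>) / 4"

text \<open>The desingularizing function of the gap, scaled by the coefficient of \<open>d\<close>
  in \<open>le_of_square_recursion\<close> for the weight \<open>\<epsilon>\<close>.\<close>

definition "U k = C * B / \<epsilon> * (c * gap k powr (1 - \<theta>))"

lemma \<epsilon>: "0 < \<epsilon>" "\<delta> + 2 * \<epsilon> < 1"
  using \<delta> by (auto simp: \<epsilon>_def field_simps)

lemma B_nonneg: "0 \<le> B"
  using l_pos \<delta>_sq by (simp add: B_def)

lemma U_nonneg: "0 \<le> U k"
  using C_nonneg B_nonneg \<epsilon> c_pos by (simp add: U_def)

lemma A_step:
  assumes k: "2 * T \<le> k" "x k \<in> ball xbar \<rho>" "S k < \<rho>" "gap k < \<eta>"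
  shows "A (k + T) \<le> \<delta> * A k + \<epsilon> * (A k + A (k - T)) + (U k - U (k + T))"
proof -
  define d where "d = c * gap k powr (1 - \<theta>) - c * gap (k + T) powr (1 - \<theta>)"
  define s where "s = A k + A (k - T)"
  have s: "0 \<le> s" by (simp add: s_def A_nonneg)
  have gap': "0 \<le> gap (k + T)" "gap (k + T) \<le> gap k"
    unfolding gap_def using \<Phi>_xbar_le[of "k + T"] \<Phi>_decreasing[of k "k + T"] k by auto
  have d: "0 \<le> d"
    unfolding d_def using c_pos gap' \<theta> by (simp add: powr_mono2)
  have "gap k - gap (k + T) \<le> C * B * s * d"
  proof (cases "gap k = 0")
    case True
    then show ?thesis using gap' s d C_nonneg B_nonneg by simp
  next
    case False
    then have pos: "0 < gap k" using gap' by linarith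
    define p where "p = c * ((1 - \<theta>) * gap k powr (- \<theta>))"
    have "0 \<le> p" unfolding p_def using c_pos \<theta> by simp
    have "1 \<le> p * (C * S k)"
      unfolding p_def using KL_step k pos by blast
    also have "\<dots> \<le> p * (C * (B * s))"
      using S_le[OF k(1)] \<open>0 \<le> p\<close> C_nonneg by (intro mult_left_mono) (auto simp: s_def)
    \<comment> \<open>The KL inequality, multiplied by the decrease of the gap; concavity then
      bounds \<open>p\<close> times this decrease by \<open>d\<close>.\<close>
    finally have "gap k - gap (k + T) \<le> p * (C * (B * s)) * (gap k - gap (k + T))"
      using gap' by (metis diff_ge_0_iff_ge mult_1 mult_right_mono)
    also have "\<dots> = C * B * s * (p * (gap k - gap (k + T)))" by simp
    also have "p * (gap k - gap (k + T)) \<le> d"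
      using powr_diff_ge[OF pos gap'(1), of "1 - \<theta>"] \<theta> c_pos
      by (simp add: p_def d_def mult.assoc flip: right_diff_distrib)
    then have "C * B * s * (p * (gap k - gap (k + T))) \<le> C * B * s * d"
      using s C_nonneg B_nonneg by (intro mult_left_mono) auto
    finally show ?thesis .
  qed
  moreover have "(A (k + T))\<^sup>2 \<le> \<delta>\<^sup>2 * (A k)\<^sup>2 + 4 * (gap k - gap (k + T))"
    using A_sq_step[of k] k by (simp add: gap_def)
  ultimately have "(A (k + T))\<^sup>2 \<le> \<delta>\<^sup>2 * (A k)\<^sup>2 + 4 * (C * B) * s * d" by simp
  then have "A (k + T) \<le> \<delta> * A k + \<epsilon> * s + C * B / \<epsilon> * d"
    using \<epsilon> \<delta> A_nonneg s d C_nonneg B_nonneg by (intro le_of_square_recursion) auto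
  moreover have "C * B / \<epsilon> * d = U k - U (k + T)" by (simp add: d_def U_def right_diff_distrib)
  ultimately show ?thesis by (simp add: s_def)
qed

text \<open>A Lyapunov function: the extra \<open>\<epsilon> * A k\<close> pays for the term
  \<open>\<epsilon> * A k\<close> that enters \<open>E (k + T)\<close>, so that
  \<open>A_step\<close> telescopes.\<close>

definition "E k = (\<delta> + 2 * \<epsilon>) * A k + \<epsilon> * A (k - T) + U k"

lemma E_nonneg: "0 \<le> E k"
  using \<epsilon> \<delta> A_nonneg U_nonneg by (simp add: E_def)

lemma E_step:
  assumes "2 * T \<le> k" "x k \<in> ball xbar \<rho>" "S k < \<rho>" "gap k < \<eta>"
  shows "(1 - \<delta> - 2 * \<epsilon>) * A (k + T) + E (k + T) \<le> E k"
  using A_step[OF assms] by (simp add: E_def algebra_simps)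

lemma E_\<phi>_tendsto_0: "(\<lambda>n. E (\<phi> n)) \<longlonglongrightarrow> 0"
proof -
  have A0: "(\<lambda>n. A (\<phi> n)) \<longlonglongrightarrow> 0" "(\<lambda>n. A (\<phi> n - T)) \<longlonglongrightarrow> 0"
    using filterlim_compose[OF A_tendsto_0[OF W_vanishes] \<phi>_at_top]
      filterlim_compose[OF A_tendsto_0[OF W_vanishes]
        filterlim_compose[OF filterlim_minus_const_nat_at_top \<phi>_at_top]] by auto
  have gap: "(\<lambda>n. gap (\<phi> n)) \<longlonglongrightarrow> 0"
    using tendsto_diff[OF \<Phi>_tendsto tendsto_const[of "\<Phi> xbar"]] by (simp add: gap_def)
  have "(\<lambda>n. gap (\<phi> n) powr (1 - \<theta>)) \<longlonglongrightarrow> 0 powr (1 - \<theta>)"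
    using \<theta> \<Phi>_xbar_le \<phi>_ge_T by (intro tendsto_powr' gap tendsto_const) (auto simp: gap_def)
  then have "(\<lambda>n. U (\<phi> n)) \<longlonglongrightarrow> C * B / \<epsilon> * (c * 0)"
    unfolding U_def by (intro tendsto_mult tendsto_const) simp
  then have "(\<lambda>n. E (\<phi> n)) \<longlonglongrightarrow> (\<delta> + 2 * \<epsilon>) * 0 + \<epsilon> * 0 + C * B / \<epsilon> * (c * 0)"
    unfolding E_def by (intro tendsto_intros A0)
  then show ?thesis by simp
qed

section \<open>Trapping the iterates near the limit point\<close>

lemma stays_in_ball:
  assumes "0 < \<tau>" "\<tau> \<le> \<rho>" and k: "2 * T \<le> k" "gap k < \<eta>" "dist xbar (x k) < \<tau> / 2"
    and S: "\<And>t. k \<le> t \<Longrightarrow> S t < \<rho>"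
    and E: "B * E k < (1 - \<delta> - 2 * \<epsilon>) * (\<tau> / 2)"
  shows "x (k + n * T) \<in> ball xbar \<tau>"
proof -
  define \<kappa> where "\<kappa> = 1 - \<delta> - 2 * \<epsilon>"
  have \<kappa>: "0 < \<kappa>" using \<epsilon> by (simp add: \<kappa>_def)
  have in_ball: "x (k + n * T) \<in> ball xbar \<tau>"
    if sum: "\<kappa> * (\<Sum>i<n. A (k + Suc i * T)) \<le> E k" for n
  proof -
    have "norm (x (k + n * T) - x k) \<le> B * (\<Sum>i<n. A (k + Suc i * T))"
    proof (induction n)
      case (Suc n)
      have "norm (x (k + Suc n * T) - x (k + n * T)) \<le> B * A (k + Suc n * T)"
        using norm_iterates_diff_le[of "k + n * T" "k + Suc n * T"]
          window_sum_le[of "k + Suc n * T"] by simp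
      moreover have "norm (x (k + Suc n * T) - x k)
          \<le> norm (x (k + Suc n * T) - x (k + n * T)) + norm (x (k + n * T) - x k)"
        using norm_triangle_ineq[of "x (k + Suc n * T) - x (k + n * T)" "x (k + n * T) - x k"] by simp
      ultimately show ?case using Suc by (simp add: distrib_left)
    qed simp
    then have "\<kappa> * norm (x (k + n * T) - x k) \<le> B * (\<kappa> * (\<Sum>i<n. A (k + Suc i * T)))"
      using \<kappa> by (simp add: mult.left_commute)
    also have "\<dots> \<le> B * E k" using sum B_nonneg by (rule mult_left_mono)
    also have "\<dots> < \<kappa> * (\<tau> / 2)" using E by (simp add: \<kappa>_def)
    finally have "norm (x (k + n * T) - x k) < \<tau> / 2" using \<kappa> by simp
    moreover have "dist xbar (x (k + n * T)) \<le> dist xbar (x k) + norm (x (k + n * T) - x k)"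
      by (metis dist_norm dist_triangle norm_minus_commute)
    ultimately show ?thesis using k(3) by simp
  qed
  \<comment> \<open>Energy bound and location are proved together: the bound up to \<open>n\<close>
    puts the point \<open>k + n * T\<close> into the ball, where \<open>E_step\<close> yields the
    next bound.\<close>
  have "\<kappa> * (\<Sum>i<n. A (k + Suc i * T)) + E (k + n * T) \<le> E k"
  proof (induction n)
    case (Suc n)
    then have "\<kappa> * (\<Sum>i<n. A (k + Suc i * T)) \<le> E k" using E_nonneg[of "k + n * T"] by linarith
    then have "x (k + n * T) \<in> ball xbar \<rho>" using in_ball assms(2) by force
    moreover have "gap (k + n * T) < \<eta>"
      using \<Phi>_decreasing[of k "k + n * T"] k by (simp add: gap_def)
    ultimately have "\<kappa> * A (k + n * T + T) + E (k + n * T + T) \<le> E (k + n * T)"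
      unfolding \<kappa>_def using k S by (intro E_step) auto
    then show ?case using Suc by (simp add: distrib_left add.commute add.left_commute)
  qed simp
  then show ?thesis using in_ball E_nonneg[of "k + n * T"] by (smt (verit))
qed

theorem convergence: "x \<longlonglongrightarrow> xbar"
proof (rule metric_LIMSEQ_I)
  fix \<tau>' :: real assume "0 < \<tau>'"
  \<comment> \<open>An iterate is within \<open>\<tau>\<close> of the preceding point of the grid
    \<open>k + n * T\<close>, which is within \<open>\<tau>\<close> of \<open>xbar\<close>; hence
    the half.\<close>
  define \<tau> where "\<tau> = min (\<tau>' / 2) \<rho>"
  have \<tau>: "0 < \<tau>" "\<tau> \<le> \<rho>" "2 * \<tau> \<le> \<tau>'" using \<open>0 < \<tau>'\<close> \<rho>_pos by (auto simp: \<tau>_def)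
  define \<kappa> where "\<kappa> = 1 - \<delta> - 2 * \<epsilon>"
  have \<kappa>: "0 < \<kappa>" using \<epsilon> by (simp add: \<kappa>_def)
  obtain N where N: "\<And>t. N \<le> t \<Longrightarrow> S t < \<tau>"
    using order_tendstoD(2)[OF S_tendsto_0[OF W_vanishes] \<tau>(1)] by (auto simp: eventually_sequentially)
  have "(\<lambda>n. B * E (\<phi> n)) \<longlonglongrightarrow> B * 0"
    by (intro tendsto_intros E_\<phi>_tendsto_0)
  then have 1: "\<forall>\<^sub>F n in sequentially. B * E (\<phi> n) < \<kappa> * (\<tau> / 2)"
    using \<kappa> \<tau> by (intro order_tendstoD(2)) auto
  have 2: "\<forall>\<^sub>F n in sequentially. dist xbar (x (\<phi> n)) < \<tau> / 2"
    using tendstoD[OF subsequence, of "\<tau> / 2"] \<tau> by (simp add: dist_commute)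
  have 3: "\<forall>\<^sub>F n in sequentially. \<Phi> (x (\<phi> n)) < \<Phi> xbar + \<eta>"
    using \<eta>_pos by (intro order_tendstoD(2)[OF \<Phi>_tendsto]) simp
  have 4: "\<forall>\<^sub>F n in sequentially. N \<le> \<phi> n"
    using \<phi>_at_top by (simp add: filterlim_at_top)
  \<comment> \<open>One index of the subsequence with small energy, distance and gap is enough to
    trap all later iterates.\<close>
  obtain n0 where n0: "B * E (\<phi> n0) < \<kappa> * (\<tau> / 2)" "dist xbar (x (\<phi> n0)) < \<tau> / 2"
    "\<Phi> (x (\<phi> n0)) < \<Phi> xbar + \<eta>" "N \<le> \<phi> n0"
    using eventually_happens'[OF _ eventually_conj[OF 1 eventually_conj[OF 2 eventually_conj[OF 3 4]]]]
    by auto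
  define k where "k = \<phi> n0"
  have "S t < \<rho>" if "k \<le> t" for t
    using N[of t] n0(4) \<tau>(2) that by (simp add: k_def)
  then have grid: "x (k + n * T) \<in> ball xbar \<tau>" for n
    using \<tau> n0 \<phi>_ge unfolding \<kappa>_def k_def
    by (intro stays_in_ball) (auto simp: gap_def)
  have "dist (x t) xbar < \<tau>'" if "k \<le> t" for t
  proof -
    define n where "n = (t - k) div T"
    define u where "u = k + n * T"
    have u: "u \<le> t" "t < u + T"
      using that T_pos div_mult_mod_eq[of "t - k" T] mod_less_divisor[of T "t - k"]
      unfolding u_def n_def by linarith+
    have "2 * T \<le> t" using that \<phi>_ge[of n0] by (simp add: k_def)
    have "norm (x t - x u) \<le> (\<Sum>s\<in>{u<..t}. D s)" using u by (intro norm_iterates_diff_le)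
    also have "\<dots> \<le> S t"
      unfolding S_def using u \<open>2 * T \<le> t\<close> by (intro sum_mono2 D_nonneg) auto
    also have "\<dots> < \<tau>" using N n0 that by (simp add: k_def)
    finally have "dist (x t) (x u) < \<tau>" by (simp add: dist_norm)
    moreover have "dist (x u) xbar < \<tau>" using grid[of n] by (simp add: u_def dist_commute)
    ultimately show ?thesis using dist_triangle[of "x t" xbar "x u"] \<tau> by linarith
  qed
  then show "\<exists>no. \<forall>t\<ge>no. dist (x t) xbar < \<tau>'" by blast
qed

end

section \<open>From the stated assumptions to the locale\<close>

theorem theorem2p7:
  fixes \<beta> :: "'n::finite \<Rightarrow> 's::finite"
    and f :: "real ^ 'n \<Rightarrow> real"
    and r :: "'s \<Rightarrow> real ^ 'n \<Rightarrow> ereal"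
    and b :: "nat \<Rightarrow> 's"
    and L0 :: "'s \<Rightarrow> real"
    and L \<alpha> \<omega> :: "nat \<Rightarrow> real"
    and x :: "nat \<Rightarrow> real ^ 'n"
    and xbar :: "real ^ 'n"
    and \<rho> \<eta> \<theta> :: real
  assumes "assumption1 \<beta> f r"
    and "assumption2 \<beta> f b x L"
    and "assumption3 b"
    and "parameter_choice b L0 L \<alpha> \<omega>"
    and "BPL_iterates \<beta> f r b \<alpha> \<omega> x"
    and "\<And>k. k \<ge> 1 \<Longrightarrow> objective \<beta> f r (x k) \<le> objective \<beta> f r (x (k - 1))"
    and "\<exists>\<phi>. strict_mono \<phi> \<and> (x \<circ> \<phi>) \<longlonglongrightarrow> xbar"
    and "KL_property (objective \<beta> f r) xbar \<rho> \<eta> \<theta>"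
    and "\<And>i. \<exists>LG. LG-lipschitz_on (ball xbar (4 * \<rho>)) (\<lambda>y. block \<beta> i (grad f y))"
  shows "x \<longlonglongrightarrow> xbar"
proof -
  have "\<exists>T. \<forall>k\<ge>1. \<forall>i. \<exists>m\<in>{k..<k + T}. b m = i"
    using assms(3) unfolding assumption3_def .
  then obtain T where T: "\<And>k i. k \<ge> 1 \<Longrightarrow> \<exists>m\<in>{k..<k + T}. b m = i" by blast
  have "infinite {k. 1 \<le> k \<and> b k = i}" for i
    unfolding infinite_nat_iff_unbounded_le
  proof
    fix k
    obtain m where "m \<in> {Suc k..<Suc k + T}" "b m = i" using T[of "Suc k" i] by auto
    then show "\<exists>m\<ge>k. m \<in> {k. 1 \<le> k \<and> b k = i}" by (intro exI[of _ m]) auto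
  qed
  then obtain \<delta> where \<delta>: "0 \<le> \<delta>" "\<delta> < 1"
    "\<And>m k. 1 \<le> m \<Longrightarrow> m < k \<Longrightarrow> b m = b k \<Longrightarrow> \<forall>t\<in>{m<..<k}. b t \<noteq> b k \<Longrightarrow>
      \<omega> k \<le> \<delta> / 6 * sqrt (L m / L k)"
    using parameter_choice_consecutive[OF assms(4)] by blast
  obtain l M where lM: "0 < l" "\<And>k. k \<ge> 1 \<Longrightarrow> l \<le> L k" "\<And>k. k \<ge> 1 \<Longrightarrow> L k \<le> M"
    using assms(2) unfolding assumption2_def by blast
  have lip: "\<And>k. k \<ge> 1 \<Longrightarrow> (L k)-lipschitz_on (block_space \<beta> (b k))
      (\<lambda>u. block \<beta> (b k) (grad f (replace_block \<beta> (b k) (x (k - 1)) u)))"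
    using assms(2) unfolding assumption2_def by blast
  note A1 = assms(1)[unfolded assumption1_def]
  have grad: "\<And>y. gderiv f y (grad f y)" "continuous_on UNIV (grad f)"
    using A1 gderiv_grad unfolding continuously_differentiable_def by blast+
  have r: "\<And>i. proper_on (block_space \<beta> i) (r i)" "\<And>i. lsc_on (block_space \<beta> i) (r i)"
    using A1 by blast+
  have steps: "\<And>k. k \<ge> 1 \<Longrightarrow> \<alpha> k = 1 / (2 * L k)" "\<And>k. k \<ge> 1 \<Longrightarrow> 0 \<le> \<omega> k" "\<And>k. k \<ge> 1 \<Longrightarrow> \<omega> k \<le> 1"
    using assms(4) unfolding parameter_choice_def by blast+
  obtain lower where lower: "\<And>y. y \<in> edom (objective \<beta> f r) \<Longrightarrow> ereal lower \<le> objective \<beta> f r y"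
    using A1 by blast
  obtain \<psi> where \<psi>: "strict_mono \<psi>" "(x \<circ> \<psi>) \<longlonglongrightarrow> xbar" using assms(7) by blast
  \<comment> \<open>Dropping the first \<open>2 * T\<close> members makes every double window ending
    at \<open>\<phi> n\<close> complete.\<close>
  define \<phi> where "\<phi> n = \<psi> (n + 2 * T)" for n
  have \<phi>: "strict_mono \<phi>" using \<psi>(1) unfolding \<phi>_def strict_mono_def by simp
  have \<phi>_ge: "2 * T \<le> \<phi> n" for n
    unfolding \<phi>_def using strict_mono_imp_increasing[OF \<psi>(1), of "n + 2 * T"] by simp
  have lim: "(\<lambda>n. x (\<phi> n)) \<longlonglongrightarrow> xbar"
    using LIMSEQ_ignore_initial_segment[OF \<psi>(2), of "2 * T"] by (simp add: \<phi>_def)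
  have KL: "0 < \<rho>" "0 < \<eta>" "0 \<le> \<theta>" "\<theta> < 1"
    using assms(8) unfolding KL_property_def by blast+
  obtain c where c: "0 < c" "\<And>y. y \<in> ball xbar \<rho> \<Longrightarrow> y \<in> dom_subdiff (objective \<beta> f r) \<Longrightarrow>
      objective \<beta> f r xbar < objective \<beta> f r y \<Longrightarrow> objective \<beta> f r y < objective \<beta> f r xbar + ereal \<eta> \<Longrightarrow>
      1 \<le> deriv (\<lambda>a. c * a powr (1 - \<theta>)) (real_of_ereal \<bar>objective \<beta> f r y - objective \<beta> f r xbar\<bar>)
        * infdist 0 (limiting_subdiff (objective \<beta> f r) y)"
    using assms(8) unfolding KL_property_def by blast
  obtain LG where LG:
    "\<And>i. LG-lipschitz_on (ball xbar (4 * \<rho>)) (\<lambda>y. block \<beta> i (grad f y))"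
  proof -
    obtain K where K: "\<And>i. (K i)-lipschitz_on (ball xbar (4 * \<rho>)) (\<lambda>y. block \<beta> i (grad f y))"
      using assms(9) by metis
    \<comment> \<open>There are finitely many blocks, so one constant serves them all.\<close>
    have "(Max (range K))-lipschitz_on (ball xbar (4 * \<rho>)) (\<lambda>y. block \<beta> i (grad f y))" for i
      by (rule lipschitz_on_le[OF K]) simp
    then show ?thesis by (rule that)
  qed
  interpret block_prox_linear_KL \<beta> f r b L \<alpha> \<omega> x T l M \<delta> xbar \<phi> \<rho> \<eta> \<theta> c LG lower
    by unfold_locales (fact grad r lip lM T steps \<delta> assms(5,6) lower filterlim_subseq[OF \<phi>] \<phi>_ge lim KL c LG)+
  show ?thesis by (rule convergence)
qed

end
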